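(* Let $\alpha\geq 0$ and let $p\neq 1$ be a positive integer. For $\lambda\in(0,1)$ let $$W_\lambda(x)=\sqrt{2}\sum_{j=0}^\infty\lambda^j\sin(p^j\pi x).$$ Let $\{\lambda_n\}_{n=1}^\infty\in(0,p^{-\alpha})^\infty$ be a sequence with $\sup_n\lambda_n<p^{-\alpha}$ and suppose that there exists $N\in\mathbb{N}$ such that $\lambda_n=\lambda_{pn}$ for all $n\geq N$. Let $$w_n(x)=\frac{1}{n^\alpha}W_{\lambda_n}(nx),\qquad n\in\mathbb{N}.$$ Then $\{w_n\}_{n=1}^\infty$ is a Riesz basis of $\mathrm{H}^\alpha$.
   Context: For $\alpha\geq0$, $\mathrm{H}^\alpha=\mathrm{H}^\alpha(0,1)$ denotes the Hilbert space of functions $f\in L^2(0,1)$ with $\sum_{n=1}^\infty n^{2\alpha}|\hat f(n)|^2<\infty$, where $\hat f(n)=\sqrt2\int_0^1f(x)\sin(n\pi x)\,dx$, with inner product $\langle f,g\rangle_\alpha=\sum_{n=1}^\infty n^{2\alpha}\hat f(n)\overline{\hat g(n)}$; it is considered over the complex field. The functions $h_n(x)=\frac{\sqrt2}{n^\alpha}\sin(n\pi x)$ form an orthonormal basis of $\mathrm{H}^\alpha$. A Riesz basis of a Hilbert space is the image of an orthonormal basis under a bounded operator with bounded inverse. For a set $J$, $J^\infty$ denotes the set of sequences $\{s_n\}_{n=1}^\infty$ with $s_n\in J$. *)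

theory Defs
  imports "HOL-Analysis.Analysis"
begin

section \<open>The space of square-integrable functions on the unit interval\<close>

definition square_integrable :: "(real \<Rightarrow> complex) \<Rightarrow> bool" where
  "square_integrable f \<longleftrightarrow>
     f \<in> borel_measurable (lebesgue_on {0<..<1}) \<and>
     integrable (lebesgue_on {0<..<1}) (\<lambda>x. (cmod (f x))\<^sup>2)"

definition L2_eq :: "(real \<Rightarrow> complex) \<Rightarrow> (real \<Rightarrow> complex) \<Rightarrow> bool" where
  "L2_eq f g \<longleftrightarrow> square_integrable f \<and> square_integrable g \<and>
     (AE x in lebesgue_on {0<..<1}. f x = g x)"

lemma square_integrable_zero: "square_integrable (\<lambda>x. 0)"
  by (simp add: square_integrable_def)

lemma square_integrable_scale:
  assumes "square_integrable f"
  shows "square_integrable (\<lambda>x. c * f x)"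
  using assms by (auto simp: square_integrable_def norm_mult power_mult_distrib)

lemma square_integrable_add:
  assumes "square_integrable f" "square_integrable g"
  shows "square_integrable (\<lambda>x. f x + g x)"
proof -
  let ?M = "lebesgue_on {0<..<1::real}"
  have m [measurable]: "f \<in> borel_measurable ?M" "g \<in> borel_measurable ?M"
    using assms by (auto simp: square_integrable_def)
  have "integrable ?M (\<lambda>x. 2 * (cmod (f x))\<^sup>2 + 2 * (cmod (g x))\<^sup>2)"
    using assms by (auto simp: square_integrable_def)
  then have "integrable ?M (\<lambda>x. (cmod (f x + g x))\<^sup>2)"
  proof (rule Bochner_Integration.integrable_bound)
    show "(\<lambda>x. (cmod (f x + g x))\<^sup>2) \<in> borel_measurable ?M" by measurable
    have "(cmod (f x + g x))\<^sup>2 \<le> 2 * (cmod (f x))\<^sup>2 + 2 * (cmod (g x))\<^sup>2" for x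
    proof -
      have "(cmod (f x + g x))\<^sup>2 \<le> (cmod (f x) + cmod (g x))\<^sup>2"
        by (intro power_mono norm_triangle_ineq) auto
      also have "\<dots> \<le> 2 * (cmod (f x))\<^sup>2 + 2 * (cmod (g x))\<^sup>2"
        using sum_squares_bound[of "cmod (f x)" "cmod (g x)"]
        by (simp add: power2_sum)
      finally show ?thesis .
    qed
    then show "AE x in ?M. norm ((cmod (f x + g x))\<^sup>2)
        \<le> norm (2 * (cmod (f x))\<^sup>2 + 2 * (cmod (g x))\<^sup>2)"
      by auto
  qed
  then show ?thesis
    by (simp add: square_integrable_def)
qed

text \<open>
  \<open>L2_class f\<close> is the almost-everywhere class of \<open>f\<close>; it is meaningful only if \<open>f\<close> is
  square integrable.
\<close>

quotient_type L2 = "real \<Rightarrow> complex" / partial: L2_eq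
  morphisms L2_rep L2_class
proof (rule part_equivpI)
  show "\<exists>f. L2_eq f f"
    by (rule exI[of _ "\<lambda>x. 0"]) (simp add: L2_eq_def square_integrable_zero)
  show "symp L2_eq"
    by (rule sympI) (auto simp: L2_eq_def eq_commute)
  show "transp L2_eq"
    by (rule transpI) (auto simp: L2_eq_def elim: AE_mp)
qed

instantiation L2 :: ab_group_add
begin

lift_definition zero_L2 :: L2 is "\<lambda>x. 0"
  by (simp add: L2_eq_def square_integrable_zero)

lift_definition plus_L2 :: "L2 \<Rightarrow> L2 \<Rightarrow> L2" is "\<lambda>f g x. f x + g x"
  by (auto simp: L2_eq_def intro: square_integrable_add elim: AE_mp)

lift_definition uminus_L2 :: "L2 \<Rightarrow> L2" is "\<lambda>f x. - f x"
  using square_integrable_scale[where c = "-1"]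
  by (auto simp: L2_eq_def)

lift_definition minus_L2 :: "L2 \<Rightarrow> L2 \<Rightarrow> L2" is "\<lambda>f g x. f x - g x"
  subgoal for f f' g g'
    using square_integrable_add[of f "\<lambda>x. - g x"] square_integrable_add[of f' "\<lambda>x. - g' x"]
      square_integrable_scale[of g "-1"] square_integrable_scale[of g' "-1"]
    by (auto simp: L2_eq_def elim: AE_mp)
  done

instance
proof
  fix a b c :: L2
  show "a + b + c = a + (b + c)"
    by transfer (auto simp: L2_eq_def add.assoc intro!: square_integrable_add)
  show "a + b = b + a"
    by transfer (auto simp: L2_eq_def add.commute intro!: square_integrable_add)
  show "0 + a = a"
    by transfer (auto simp: L2_eq_def)
  show "- a + a = 0"
    by transfer (auto simp: L2_eq_def square_integrable_zero)
  show "a - b = a + - b"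
    apply transfer
    subgoal for f g
      using square_integrable_add[of f "\<lambda>x. - g x"] square_integrable_scale[of g "-1"]
      by (auto simp: L2_eq_def)
    done
qed

end

lift_definition scale_L2 :: "complex \<Rightarrow> L2 \<Rightarrow> L2" (infixr "*\<^sub>2" 75) is "\<lambda>c f x. c * f x"
  by (auto simp: L2_eq_def intro: square_integrable_scale elim: AE_mp)

global_interpretation L2: vector_space scale_L2
proof
  fix a b :: complex and x y :: L2
  show "a *\<^sub>2 (x + y) = a *\<^sub>2 x + a *\<^sub>2 y"
    by transfer (auto simp: L2_eq_def distrib_left
        intro!: square_integrable_add square_integrable_scale)
  show "(a + b) *\<^sub>2 x = a *\<^sub>2 x + b *\<^sub>2 x"
    by transfer (auto simp: L2_eq_def distrib_right
        intro!: square_integrable_add square_integrable_scale)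
  show "a *\<^sub>2 b *\<^sub>2 x = (a * b) *\<^sub>2 x"
    by transfer (auto simp: L2_eq_def mult.assoc intro!: square_integrable_scale)
  show "1 *\<^sub>2 x = x"
    by transfer (auto simp: L2_eq_def)
qed

lift_definition sine_coeff :: "L2 \<Rightarrow> nat \<Rightarrow> complex" is
  "\<lambda>(f :: real \<Rightarrow> complex) n. of_real (sqrt 2) * (LINT x|lebesgue_on {0<..<1}. f x * of_real (sin (real n * pi * x)))"
proof -
  fix f g :: "real \<Rightarrow> complex"
  assume "L2_eq f g"
  then have [measurable]: "f \<in> borel_measurable (lebesgue_on {0<..<1})"
      "g \<in> borel_measurable (lebesgue_on {0<..<1})"
    and ae: "AE x in lebesgue_on {0<..<1}. f x = g x"
    by (auto simp: L2_eq_def square_integrable_def)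
  have [measurable]: "(\<lambda>x. complex_of_real (sin (real n * pi * x)))
      \<in> borel_measurable (lebesgue_on {0<..<1})" for n
    by (intro continuous_imp_measurable_on_sets_lebesgue continuous_intros) auto
  have "(LINT x|lebesgue_on {0<..<1}. f x * of_real (sin (real n * pi * x))) =
        (LINT x|lebesgue_on {0<..<1}. g x * of_real (sin (real n * pi * x)))" for n
    using ae by (intro integral_cong_AE) (measurable, auto)
  then show "(\<lambda>n. of_real (sqrt 2) * (LINT x|lebesgue_on {0<..<1}. f x * of_real (sin (real n * pi * x)))) =
    (\<lambda>n. of_real (sqrt 2) * (LINT x|lebesgue_on {0<..<1}. g x * of_real (sin (real n * pi * x))))"
    by simp
qed


section \<open>The spaces \<open>H\<^sup>\<alpha>\<close>\<close>

definition H_space :: "real \<Rightarrow> L2 set" where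
  "H_space \<alpha> =
     {f. summable (\<lambda>n. real (Suc n) powr (2 * \<alpha>) * (cmod (sine_coeff f (Suc n)))\<^sup>2)}"

definition H_inner :: "real \<Rightarrow> L2 \<Rightarrow> L2 \<Rightarrow> complex" where
  "H_inner \<alpha> f g =
     (\<Sum>n. of_real (real (Suc n) powr (2 * \<alpha>)) *
           sine_coeff f (Suc n) * cnj (sine_coeff g (Suc n)))"


section \<open>Riesz bases\<close>

text \<open>
  In this section \<open>H\<close> is a complex linear subspace of \<open>L2\<close> that is a Hilbert space for the inner
  product \<open>ip\<close>, which in general is not the one inherited from \<open>L2\<close>.
\<close>

definition norm_of :: "(L2 \<Rightarrow> L2 \<Rightarrow> complex) \<Rightarrow> L2 \<Rightarrow> real" where
  "norm_of ip f = sqrt (Re (ip f f))"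

definition orthonormal_basis ::
    "L2 set \<Rightarrow> (L2 \<Rightarrow> L2 \<Rightarrow> complex) \<Rightarrow> 'i set \<Rightarrow> ('i \<Rightarrow> L2) \<Rightarrow> bool" where
  "orthonormal_basis H ip I e \<longleftrightarrow>
     (\<forall>i\<in>I. e i \<in> H) \<and>
     (\<forall>i\<in>I. \<forall>j\<in>I. ip (e i) (e j) = (if i = j then 1 else 0)) \<and>
     (\<forall>f\<in>H. \<forall>\<epsilon>>0. \<exists>g\<in>L2.span (e ` I). norm_of ip (f - g) < \<epsilon>)"

definition bounded_operator_on ::
    "L2 set \<Rightarrow> (L2 \<Rightarrow> L2 \<Rightarrow> complex) \<Rightarrow> (L2 \<Rightarrow> L2) \<Rightarrow> bool" where
  "bounded_operator_on H ip T \<longleftrightarrow>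
     (\<forall>f\<in>H. T f \<in> H) \<and>
     (\<forall>f\<in>H. \<forall>g\<in>H. T (f + g) = T f + T g) \<and>
     (\<forall>c. \<forall>f\<in>H. T (c *\<^sub>2 f) = c *\<^sub>2 T f) \<and>
     (\<exists>C. \<forall>f\<in>H. norm_of ip (T f) \<le> C * norm_of ip f)"

definition boundedly_invertible_on ::
    "L2 set \<Rightarrow> (L2 \<Rightarrow> L2 \<Rightarrow> complex) \<Rightarrow> (L2 \<Rightarrow> L2) \<Rightarrow> bool" where
  "boundedly_invertible_on H ip T \<longleftrightarrow>
     bounded_operator_on H ip T \<and>
     (\<exists>S. bounded_operator_on H ip S \<and> (\<forall>f\<in>H. S (T f) = f \<and> T (S f) = f))"

definition riesz_basis ::
    "L2 set \<Rightarrow> (L2 \<Rightarrow> L2 \<Rightarrow> complex) \<Rightarrow> 'i set \<Rightarrow> ('i \<Rightarrow> L2) \<Rightarrow> bool" where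
  "riesz_basis H ip I w \<longleftrightarrow>
     (\<exists>e T. orthonormal_basis H ip I e \<and> boundedly_invertible_on H ip T \<and>
        (\<forall>i\<in>I. w i = T (e i)))"


section \<open>The functions \<open>W\<^sub>\<lambda>\<close> and \<open>w\<^sub>n\<close>\<close>

definition W_fun :: "nat \<Rightarrow> real \<Rightarrow> real \<Rightarrow> real" where
  "W_fun p l x = sqrt 2 * (\<Sum>j. l ^ j * sin (real p ^ j * pi * x))"

definition w_fun :: "real \<Rightarrow> nat \<Rightarrow> (nat \<Rightarrow> real) \<Rightarrow> nat \<Rightarrow> real \<Rightarrow> real" where
  "w_fun \<alpha> p lam n x = 1 / real n powr \<alpha> * W_fun p (lam n) (real n * x)"

end

(* In the basis h_n the functions w_n are the images of h_n under T = sum_j S^j D^j, where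
   S h_n = h_{pn} and D is the diagonal operator with entries u_n = lambda_n p^alpha.  Since
   sup u_n < 1 the series converges in norm, so T is bounded.  T is triangular along each chain
   n, pn, p^2 n, ..., hence a bijection of the space of all sequences, and it only remains to bound
   c in terms of b = T c.  Split c into its finitely many entries below N, which triangularity
   bounds one after the other, and the rest.  On sequences vanishing below N the weights are
   constant along chains, so that (I - S D) T = I there. *)

theory Submission
  imports Defs
begin

section \<open>Sine series in the square-integrable functions\<close>

text \<open>The weights come from w_n = sum_j lambda_n^j p^(alpha j) h_(n p^j) = sum_j u_n^j h_(n
  p^j). Each term repeats the one number u_n, so in general T is not the inverse of I - S D, which
  sends h_n to sum_j u_n u_(pn) ... u_(p^(j-1) n) h_(n p^j). The two agree on h_n if u is constant
  along the chain of n, and the hypothesis on lambda grants this only from N on. Treating T as a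
  perturbation of the identity is no way out: with \<nu> = sup u_n the norm of T - I is bounded by
  \<nu> / (1 - \<nu>), which exceeds 1 for \<nu> > 1/2. T also carries the entries below N (the
  head) into the range beyond N, so b does not split along with c. The image of the rest is b minus
  the image of the head, and boundedness of T, applied to the head, controls it. The estimates live
  on sequences. Riesz-Fischer turns sequences into functions, and \<alpha> \<ge> 0 lets one divide
  by n^alpha on the way.\<close>

abbreviation unit_leb :: "real measure" where
  "unit_leb \<equiv> lebesgue_on {0<..<1}"

section \<open>Orthonormality of the sines on the unit interval\<close>

interpretation unit_leb: finite_measure unit_leb
  by (rule finite_measure_lebesgue_on) simp

lemma measure_unit_leb: "measure unit_leb (space unit_leb) = 1"
  by (simp add: measure_restrict_space)

lemma integrable_cos_unit_leb: "integrable unit_leb (\<lambda>x. cos (c * x))"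
  by (rule unit_leb.integrable_const_bound[where B = 1])
     (auto intro!: continuous_imp_measurable_on_sets_lebesgue continuous_intros)

text \<open>The frequency is an integer because a product of two sines produces the frequencies m -
  n and m + n.\<close>

lemma integral_cos_unit_leb:
  fixes k :: int
  shows "(LINT x|unit_leb. cos (of_int k * pi * x)) = (if k = 0 then 1 else 0)"
proof (cases "k = 0")
  case True
  then show ?thesis using measure_unit_leb by simp
next
  case False
  have "((\<lambda>x. cos (of_int k * pi * x)) has_integral
      (sin (of_int k * pi * 1) / (of_int k * pi) - sin (of_int k * pi * 0) / (of_int k * pi))) {0..1}"
    using False
    by (intro fundamental_theorem_of_calculus)
       (auto intro!: derivative_eq_intros simp flip: has_real_derivative_iff_has_vector_derivative)
  moreover have "sin (of_int k * pi) = 0"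
    by (metis mult.commute sin_npi_int)
  ultimately have "integral {0..1} (\<lambda>x. cos (of_int k * pi * x)) = 0"
    by (simp add: integral_unique)
  then show ?thesis using False
    by (simp add: lebesgue_integral_eq_integral[OF integrable_cos_unit_leb] integral_open_interval_real)
qed

text \<open>Sequences are indexed by all naturals; as \<open>sine 0\<close> is the zero function,
  the entry at 0 never influences a function.\<close>

definition sine :: "nat \<Rightarrow> real \<Rightarrow> real" where
  "sine n x = sqrt 2 * sin (real n * pi * x)"

lemma sine_0 [simp]: "sine 0 x = 0"
  by (simp add: sine_def)

lemma abs_sine_le: "\<bar>sine n x\<bar> \<le> sqrt 2"
  by (simp add: sine_def abs_mult mult_left_le)

lemma continuous_sine: "continuous_on A (sine n)"
  unfolding sine_def by (intro continuous_intros)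

lemma measurable_sine [measurable]: "sine n \<in> borel_measurable unit_leb"
  by (intro continuous_imp_measurable_on_sets_lebesgue continuous_sine) auto

text \<open>Product-to-sum leaves two cosine integrals. For m = n = 0 both are 1 and cancel, whence
  the side condition \<open>n \<noteq> 0\<close>.\<close>

lemma integral_sine_sine:
  "(LINT x|unit_leb. sine m x * sine n x) = (if m = n \<and> n \<noteq> 0 then 1 else 0)"
proof -
  have "sine m x * sine n x =
      cos (of_int (int m - int n) * pi * x) - cos (of_int (int m + int n) * pi * x)" for x
  proof -
    have "sine m x * sine n x = 2 * (sin (real m * pi * x) * sin (real n * pi * x))"
      by (simp add: sine_def)
    then show ?thesis
      by (simp add: sin_times_sin left_diff_distrib distrib_right)
  qed
  then have "(LINT x|unit_leb. sine m x * sine n x) =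
      (LINT x|unit_leb. cos (of_int (int m - int n) * pi * x)) -
      (LINT x|unit_leb. cos (of_int (int m + int n) * pi * x))"
    by (simp only: Bochner_Integration.integral_diff[OF integrable_cos_unit_leb integrable_cos_unit_leb])
  then show ?thesis
    unfolding integral_cos_unit_leb by auto
qed

section \<open>Square norms over the unit interval and finite sine sums\<close>

definition L2_sq :: "(real \<Rightarrow> complex) \<Rightarrow> real" where
  "L2_sq f = (LINT x|unit_leb. (cmod (f x))\<^sup>2)"

lemma L2_sq_nonneg: "0 \<le> L2_sq f"
  by (simp add: L2_sq_def)

lemma square_integrable_bounded:
  assumes "f \<in> borel_measurable unit_leb" "\<And>x. cmod (f x) \<le> B"
  shows "square_integrable f"
  unfolding square_integrable_def
proof
  show "integrable unit_leb (\<lambda>x. (cmod (f x))\<^sup>2)"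
    using assms by (intro unit_leb.integrable_const_bound[where B = "B\<^sup>2"]) (auto intro!: power_mono)
qed fact

lemma square_integrable_diff:
  "square_integrable f \<Longrightarrow> square_integrable g \<Longrightarrow> square_integrable (\<lambda>x. f x - g x)"
  using square_integrable_add[of f "\<lambda>x. - g x"] square_integrable_scale[of g "-1"] by simp

text \<open>A substitute for Minkowski's inequality, obtained by integrating a pointwise bound; the
  factor 2 is harmless for convergence to 0.\<close>

lemma L2_sq_add_le:
  assumes "square_integrable f" "square_integrable g"
  shows "L2_sq (\<lambda>x. f x + g x) \<le> 2 * L2_sq f + 2 * L2_sq g"
proof -
  have i: "integrable unit_leb (\<lambda>x. (cmod (f x))\<^sup>2)" "integrable unit_leb (\<lambda>x. (cmod (g x))\<^sup>2)"
    "integrable unit_leb (\<lambda>x. (cmod (f x + g x))\<^sup>2)"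
    using assms square_integrable_add[OF assms] by (auto simp: square_integrable_def)
  have le: "(cmod (f x + g x))\<^sup>2 \<le> 2 * (cmod (f x))\<^sup>2 + 2 * (cmod (g x))\<^sup>2" for x
  proof -
    have "(cmod (f x + g x))\<^sup>2 \<le> (cmod (f x) + cmod (g x))\<^sup>2"
      by (intro power_mono norm_triangle_ineq) auto
    also have "\<dots> \<le> 2 * (cmod (f x))\<^sup>2 + 2 * (cmod (g x))\<^sup>2"
      using sum_squares_bound[of "cmod (f x)" "cmod (g x)"] by (simp add: power2_sum)
    finally show ?thesis .
  qed
  have "L2_sq (\<lambda>x. f x + g x) \<le> (LINT x|unit_leb. 2 * (cmod (f x))\<^sup>2 + 2 * (cmod (g x))\<^sup>2)"
    unfolding L2_sq_def using i le by (intro integral_mono) auto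
  also have "\<dots> = 2 * L2_sq f + 2 * L2_sq g"
    unfolding L2_sq_def using i by simp
  finally show ?thesis .
qed

lemma L2_sq_scale: "L2_sq (\<lambda>x. c * f x) = (cmod c)\<^sup>2 * L2_sq f"
  by (simp add: L2_sq_def norm_mult power_mult_distrib)

text \<open>The measure is finite, so 1 + |f|^2 is an integrable majorant of |f|.\<close>

lemma integrable_square_integrable:
  assumes "square_integrable f"
  shows "integrable unit_leb f"
proof -
  have [measurable]: "f \<in> borel_measurable unit_leb" using assms by (simp add: square_integrable_def)
  have "integrable unit_leb (\<lambda>x. 1 + (cmod (f x))\<^sup>2)"
    using assms by (auto simp: square_integrable_def)
  then show ?thesis
  proof (rule Bochner_Integration.integrable_bound)
    have "cmod (f x) \<le> 1 + (cmod (f x))\<^sup>2" for x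
      using sum_squares_bound[of 1 "cmod (f x)"] norm_ge_zero[of "f x"]
      unfolding power2_eq_square by linarith
    then show "AE x in unit_leb. norm (f x) \<le> norm (1 + (cmod (f x))\<^sup>2)" by auto
  qed measurable
qed

text \<open>The variance of \<open>cmod \<circ> f\<close> over the unit interval is nonnegative.\<close>

lemma integral_norm_le_L2:
  assumes "square_integrable f"
  shows "(LINT x|unit_leb. cmod (f x)) \<le> sqrt (L2_sq f)"
proof (rule real_le_rsqrt)
  define t where "t = (LINT x|unit_leb. cmod (f x))"
  have i: "integrable unit_leb (\<lambda>x. cmod (f x))" "integrable unit_leb (\<lambda>x. (cmod (f x))\<^sup>2)"
    using integrable_square_integrable[OF assms] assms by (auto simp: square_integrable_def)
  have "0 \<le> (LINT x|unit_leb. (cmod (f x) - t)\<^sup>2)" by simp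
  also have "\<dots> = (LINT x|unit_leb. (cmod (f x))\<^sup>2 - 2 * t * cmod (f x) + t\<^sup>2)"
    by (simp add: power2_diff algebra_simps)
  also have "\<dots> = L2_sq f - 2 * t * t + t\<^sup>2"
    using i measure_unit_leb by (simp add: L2_sq_def t_def)
  finally show "(LINT x|unit_leb. cmod (f x))\<^sup>2 \<le> L2_sq f"
    by (simp add: t_def power2_eq_square)
qed

definition sine_sum :: "(nat \<Rightarrow> complex) \<Rightarrow> nat \<Rightarrow> real \<Rightarrow> complex" where
  "sine_sum a M x = (\<Sum>n<M. a n * of_real (sine n x))"

lemma measurable_sine_sum [measurable]: "sine_sum a M \<in> borel_measurable unit_leb"
  unfolding sine_sum_def by measurable

lemma square_integrable_sine_poly: "square_integrable (\<lambda>x. \<Sum>n\<in>F. a n * of_real (sine n x))"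
proof (rule square_integrable_bounded)
  show "cmod (\<Sum>n\<in>F. a n * of_real (sine n x)) \<le> (\<Sum>n\<in>F. cmod (a n) * sqrt 2)" for x
    by (intro sum_norm_le) (auto simp: norm_mult intro!: mult_left_mono abs_sine_le)
qed measurable

lemma square_integrable_sine_sum: "square_integrable (sine_sum a M)"
  using square_integrable_sine_poly[of a "{..<M}"] by (simp add: sine_sum_def[abs_def])

lemma integrable_sine_sine: "integrable unit_leb (\<lambda>x. sine m x * sine n x)"
proof (rule unit_leb.integrable_const_bound[where B = 2])
  have "\<bar>sine m x * sine n x\<bar> \<le> sqrt 2 * sqrt 2" for x
    unfolding abs_mult by (intro mult_mono abs_sine_le) auto
  then show "AE x in unit_leb. norm (sine m x * sine n x) \<le> 2" by simp
qed measurable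

lemma integral_complex_sine_sine:
  "(LINT x|unit_leb. complex_of_real (sine m x) * of_real (sine n x)) = (if m = n \<and> n \<noteq> 0 then 1 else 0)"
  by (simp add: integral_sine_sine flip: of_real_mult)

lemma integrable_complex_sine_sine [simp]:
  "integrable unit_leb (\<lambda>x. complex_of_real (sine m x) * of_real (sine n x))"
  using integrable_sine_sine[of m n] by (simp flip: of_real_mult)

text \<open>Orthonormality removes the off-diagonal terms of the expanded square. Equality may fail
  because the entry at 0 is invisible on the left.\<close>

lemma L2_sq_sine_poly_le:
  assumes "finite F"
  shows "L2_sq (\<lambda>x. \<Sum>n\<in>F. a n * of_real (sine n x)) \<le> (\<Sum>n\<in>F. (cmod (a n))\<^sup>2)"
proof -
  let ?s = "\<lambda>x. \<Sum>n\<in>F. a n * complex_of_real (sine n x)"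
  \<comment> \<open>The square is expanded as \<open>?s x\<close> times its conjugate, so the real
    integral first moves to the complex numbers.\<close>
  have "complex_of_real (L2_sq ?s) = (LINT x|unit_leb. complex_of_real ((cmod (?s x))\<^sup>2))"
    unfolding L2_sq_def by (rule integral_complex_of_real[symmetric])
  also have "\<dots> = (LINT x|unit_leb. (\<Sum>m\<in>F. \<Sum>n\<in>F. a m * cnj (a n) * (complex_of_real (sine m x) * of_real (sine n x))))"
    unfolding complex_norm_square cnj_sum complex_cnj_mult complex_cnj_complex_of_real sum_product
    by (simp only: mult_ac)
  also have "\<dots> = (\<Sum>m\<in>F. \<Sum>n\<in>F. a m * cnj (a n) * (if m = n \<and> n \<noteq> 0 then 1 else 0))"
    by (simp add: integral_complex_sine_sine)
  also have "\<dots> = (\<Sum>m\<in>F. complex_of_real (if m = 0 then 0 else (cmod (a m))\<^sup>2))"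
  proof (intro sum.cong refl)
    fix m assume m: "m \<in> F"
    have "(\<Sum>n\<in>F. a m * cnj (a n) * (if m = n \<and> n \<noteq> 0 then 1 else 0)) =
        (\<Sum>n\<in>F. if n = m then a m * cnj (a m) * (if m \<noteq> 0 then 1 else 0) else 0)"
      by (intro sum.cong) auto
    also have "\<dots> = complex_of_real (if m = 0 then 0 else (cmod (a m))\<^sup>2)"
      using assms m complex_norm_square[of "a m"] by (simp del: of_real_power)
    finally show "(\<Sum>n\<in>F. a m * cnj (a n) * (if m = n \<and> n \<noteq> 0 then 1 else 0)) =
      complex_of_real (if m = 0 then 0 else (cmod (a m))\<^sup>2)" .
  qed
  finally have "L2_sq ?s = (\<Sum>m\<in>F. if m = 0 then 0 else (cmod (a m))\<^sup>2)"
    unfolding of_real_sum[symmetric] of_real_eq_iff .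
  also have "\<dots> \<le> (\<Sum>n\<in>F. (cmod (a n))\<^sup>2)"
    by (intro sum_mono) auto
  finally show ?thesis .
qed

section \<open>Functions given by sine series\<close>

definition sine_series :: "(nat \<Rightarrow> complex) \<Rightarrow> (real \<Rightarrow> complex) \<Rightarrow> bool" where
  "sine_series a f \<longleftrightarrow> square_integrable f \<and> (\<lambda>M. L2_sq (\<lambda>x. f x - sine_sum a M x)) \<longlonglongrightarrow> 0"

lemma sine_series_add:
  assumes "sine_series a f" "sine_series b g"
  shows "sine_series (\<lambda>n. a n + b n) (\<lambda>x. f x + g x)"
  unfolding sine_series_def
proof
  have sq: "square_integrable f" "square_integrable g" using assms by (auto simp: sine_series_def)
  then show "square_integrable (\<lambda>x. f x + g x)" by (rule square_integrable_add)
  have "(\<lambda>M. 2 * L2_sq (\<lambda>x. f x - sine_sum a M x) + 2 * L2_sq (\<lambda>x. g x - sine_sum b M x)) \<longlonglongrightarrow> 2 * 0 + 2 * 0"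
    using assms by (intro tendsto_intros) (auto simp: sine_series_def)
  then have lim: "(\<lambda>M. 2 * L2_sq (\<lambda>x. f x - sine_sum a M x) + 2 * L2_sq (\<lambda>x. g x - sine_sum b M x)) \<longlonglongrightarrow> 0"
    by simp
  show "(\<lambda>M. L2_sq (\<lambda>x. f x + g x - sine_sum (\<lambda>n. a n + b n) M x)) \<longlonglongrightarrow> 0"
  proof (rule tendsto_sandwich[OF _ _ tendsto_const lim])
    show "\<forall>\<^sub>F M in sequentially. L2_sq (\<lambda>x. f x + g x - sine_sum (\<lambda>n. a n + b n) M x) \<le>
       2 * L2_sq (\<lambda>x. f x - sine_sum a M x) + 2 * L2_sq (\<lambda>x. g x - sine_sum b M x)"
    proof (rule always_eventually, rule allI)
      fix M
      have "(\<lambda>x. f x + g x - sine_sum (\<lambda>n. a n + b n) M x) =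
        (\<lambda>x. (f x - sine_sum a M x) + (g x - sine_sum b M x))"
        by (simp add: fun_eq_iff sine_sum_def distrib_right sum.distrib)
      then show "L2_sq (\<lambda>x. f x + g x - sine_sum (\<lambda>n. a n + b n) M x) \<le>
         2 * L2_sq (\<lambda>x. f x - sine_sum a M x) + 2 * L2_sq (\<lambda>x. g x - sine_sum b M x)"
        using L2_sq_add_le[of "\<lambda>x. f x - sine_sum a M x" "\<lambda>x. g x - sine_sum b M x"] sq
        by (simp add: square_integrable_diff square_integrable_sine_sum)
    qed
  qed (simp add: L2_sq_nonneg)
qed

lemma sine_series_scale:
  assumes "sine_series a f"
  shows "sine_series (\<lambda>n. c * a n) (\<lambda>x. c * f x)"
  unfolding sine_series_def
proof
  show "square_integrable (\<lambda>x. c * f x)"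
    using assms by (simp add: sine_series_def square_integrable_scale)
  have "(\<lambda>M. (cmod c)\<^sup>2 * L2_sq (\<lambda>x. f x - sine_sum a M x)) \<longlonglongrightarrow> (cmod c)\<^sup>2 * 0"
    using assms by (intro tendsto_intros) (auto simp: sine_series_def)
  moreover have "c * f x - sine_sum (\<lambda>n. c * a n) M x = c * (f x - sine_sum a M x)" for M x
    by (simp add: sine_sum_def right_diff_distrib sum_distrib_left mult.assoc)
  ultimately show "(\<lambda>M. L2_sq (\<lambda>x. c * f x - sine_sum (\<lambda>n. c * a n) M x)) \<longlonglongrightarrow> 0"
    by (simp add: L2_sq_scale)
qed

lemma L2_sq_eq_0_imp:
  assumes "square_integrable f" "L2_sq f = 0"
  shows "AE x in unit_leb. f x = 0"
proof -
  have "AE x in unit_leb. (cmod (f x))\<^sup>2 = 0"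
    using assms unfolding L2_sq_def
    by (subst integral_nonneg_eq_0_iff_AE[symmetric]) (auto simp: square_integrable_def)
  then show ?thesis by simp
qed

text \<open>The zero sequence is a series of f - g and has vanishing partial sums, so a constant
  sequence of square norms tends to 0.\<close>

lemma sine_series_unique:
  assumes "sine_series a f" "sine_series a g"
  shows "L2_eq f g"
proof -
  have sq: "square_integrable f" "square_integrable g" using assms by (auto simp: sine_series_def)
  have "sine_series (\<lambda>n. - 1 * a n) (\<lambda>x. - 1 * g x)" by (rule sine_series_scale) fact
  from sine_series_add[OF assms(1) this]
  have "sine_series (\<lambda>n. 0) (\<lambda>x. f x - g x)" by simp
  then have "(\<lambda>M. L2_sq (\<lambda>x. f x - g x)) \<longlonglongrightarrow> 0" by (simp add: sine_series_def sine_sum_def)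
  then have "L2_sq (\<lambda>x. f x - g x) = 0" by (simp add: LIMSEQ_const_iff)
  from L2_sq_eq_0_imp[OF square_integrable_diff[OF sq] this] sq
  show ?thesis by (simp add: L2_eq_def)
qed

lemma integrable_mult_sine:
  assumes "square_integrable g"
  shows "integrable unit_leb (\<lambda>x. g x * complex_of_real (sine n x))"
proof (rule Bochner_Integration.integrable_bound)
  show "integrable unit_leb (\<lambda>x. sqrt 2 * cmod (g x))"
    using integrable_square_integrable[OF assms] by auto
  have [measurable]: "g \<in> borel_measurable unit_leb" using assms by (simp add: square_integrable_def)
  show "(\<lambda>x. g x * complex_of_real (sine n x)) \<in> borel_measurable unit_leb" by measurable
  have "cmod (g x) * \<bar>sine n x\<bar> \<le> sqrt 2 * cmod (g x)" for x
    using mult_left_mono[OF abs_sine_le[of n x] norm_ge_zero[of "g x"]] by (simp add: mult.commute)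
  then show "AE x in unit_leb. norm (g x * complex_of_real (sine n x)) \<le> norm (sqrt 2 * cmod (g x))"
    by (simp add: norm_mult abs_mult)
qed

text \<open>Pairing with \<open>sine n\<close> is continuous in the L2 norm, and the pairing of
  \<open>sine_sum a M\<close> is already \<open>a n\<close> once M > n.\<close>

lemma sine_series_coeff:
  assumes "sine_series a f" and n: "n \<noteq> 0"
  shows "(LINT x|unit_leb. f x * of_real (sine n x)) = a n"
proof -
  have f: "square_integrable f" using assms by (simp add: sine_series_def)
  let ?I = "LINT x|unit_leb. f x * complex_of_real (sine n x)"
  have partial: "(LINT x|unit_leb. sine_sum a M x * complex_of_real (sine n x)) = a n" if "M > n" for M
  proof -
    have "(LINT x|unit_leb. sine_sum a M x * complex_of_real (sine n x)) =
      (LINT x|unit_leb. (\<Sum>m<M. a m * (complex_of_real (sine m x) * complex_of_real (sine n x))))"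
      by (simp add: sine_sum_def sum_distrib_right mult.assoc)
    also have "\<dots> = (\<Sum>m<M. a m * (if m = n \<and> n \<noteq> 0 then 1 else 0))"
      by (simp add: integral_complex_sine_sine)
    also have "\<dots> = (\<Sum>m<M. if m = n then a n else 0)"
      using n by (intro sum.cong) auto
    also have "\<dots> = a n" using that by simp
    finally show ?thesis .
  qed
  have "(\<lambda>M. ?I - a n) \<longlonglongrightarrow> 0"
  proof (rule Lim_null_comparison)
    have "(\<lambda>M. sqrt 2 * sqrt (L2_sq (\<lambda>x. f x - sine_sum a M x))) \<longlonglongrightarrow> sqrt 2 * sqrt 0"
      using assms by (intro tendsto_intros) (auto simp: sine_series_def)
    then show "(\<lambda>M. sqrt 2 * sqrt (L2_sq (\<lambda>x. f x - sine_sum a M x))) \<longlonglongrightarrow> 0" by simp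
    show "\<forall>\<^sub>F M in sequentially. norm (?I - a n) \<le> sqrt 2 * sqrt (L2_sq (\<lambda>x. f x - sine_sum a M x))"
      using eventually_gt_at_top[of n]
    proof eventually_elim
      case (elim M)
      have d: "square_integrable (\<lambda>x. f x - sine_sum a M x)"
        by (intro square_integrable_diff f square_integrable_sine_sum)
      have "?I - a n = (LINT x|unit_leb. (f x - sine_sum a M x) * complex_of_real (sine n x))"
        unfolding left_diff_distrib partial[OF elim, symmetric]
        by (intro Bochner_Integration.integral_diff[symmetric] integrable_mult_sine f square_integrable_sine_sum)
      also have "norm \<dots> \<le> (LINT x|unit_leb. sqrt 2 * cmod (f x - sine_sum a M x))"
      proof (rule Bochner_Integration.integral_norm_bound_integral)
        show "integrable unit_leb (\<lambda>x. sqrt 2 * cmod (f x - sine_sum a M x))"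
          using integrable_square_integrable[OF d] by auto
        fix x
        show "norm ((f x - sine_sum a M x) * complex_of_real (sine n x)) \<le> sqrt 2 * cmod (f x - sine_sum a M x)"
          using mult_left_mono[OF abs_sine_le[of n x] norm_ge_zero[of "f x - sine_sum a M x"]]
          by (simp add: norm_mult mult.commute)
      qed (rule integrable_mult_sine[OF d])
      also have "\<dots> \<le> sqrt 2 * sqrt (L2_sq (\<lambda>x. f x - sine_sum a M x))"
        using integral_norm_le_L2[OF d] by simp
      finally show ?case .
    qed
  qed
  then show ?thesis by (simp add: LIMSEQ_const_iff)
qed

text \<open>Links expansions to pointwise series, which later identifies \<open>w_fun\<close>. The
  sum and its partial sums are all bounded by B, so dominated convergence applies with the constant
  (2 B)^2.\<close>

lemma sine_series_absolutely_summable: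
  assumes a: "summable (\<lambda>n. cmod (a n))"
  shows "sine_series a (\<lambda>x. \<Sum>n. a n * of_real (sine n x))"
proof -
  let ?f = "\<lambda>x. \<Sum>n. a n * complex_of_real (sine n x)"
  define B where "B = (\<Sum>n. cmod (a n) * sqrt 2)"
  have le: "cmod (a n * complex_of_real (sine n x)) \<le> cmod (a n) * sqrt 2" for n x
    by (auto simp: norm_mult intro!: mult_left_mono abs_sine_le)
  have sB: "summable (\<lambda>n. cmod (a n) * sqrt 2)" using a by (rule summable_mult2)
  have s: "summable (\<lambda>n. a n * complex_of_real (sine n x))" for x
    by (rule summable_comparison_test'[OF sB le])
  have sn: "summable (\<lambda>n. cmod (a n * complex_of_real (sine n x)))" for x
    by (rule summable_comparison_test'[OF sB]) (use le in auto)
  have m [measurable]: "?f \<in> borel_measurable unit_leb" by measurable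
  have fB: "cmod (?f x) \<le> B" for x
  proof -
    have "cmod (?f x) \<le> (\<Sum>n. cmod (a n * complex_of_real (sine n x)))"
      by (rule summable_norm[OF sn])
    also have "\<dots> \<le> B" unfolding B_def by (rule suminf_le[OF le sn sB])
    finally show ?thesis .
  qed
  have sB': "cmod (sine_sum a M x) \<le> B" for M x
  proof -
    have "cmod (sine_sum a M x) \<le> (\<Sum>n<M. cmod (a n) * sqrt 2)"
      unfolding sine_sum_def by (intro sum_norm_le le)
    also have "\<dots> \<le> B" unfolding B_def by (intro sum_le_suminf sB) auto
    finally show ?thesis .
  qed
  have "(\<lambda>M. LINT x|unit_leb. (cmod (?f x - sine_sum a M x))\<^sup>2) \<longlonglongrightarrow> (LINT x|unit_leb. 0::real)"
  proof (rule integral_dominated_convergence)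
    show "integrable unit_leb (\<lambda>x. (2 * B)\<^sup>2)" by simp
    show "AE x in unit_leb. (\<lambda>M. (cmod (?f x - sine_sum a M x))\<^sup>2) \<longlonglongrightarrow> 0"
    proof (rule AE_I2)
      fix x
      have "(\<lambda>M. (cmod (?f x - sine_sum a M x))\<^sup>2) \<longlonglongrightarrow> (cmod (?f x - ?f x))\<^sup>2"
        unfolding sine_sum_def using summable_LIMSEQ[OF s[of x]] by (intro tendsto_intros)
      then show "(\<lambda>M. (cmod (?f x - sine_sum a M x))\<^sup>2) \<longlonglongrightarrow> 0" by simp
    qed
    fix M
    have "cmod (?f x - sine_sum a M x) \<le> 2 * B" for x
      using norm_triangle_ineq4[of "?f x" "sine_sum a M x"] fB[of x] sB'[of M x] by linarith
    then have "(cmod (?f x - sine_sum a M x))\<^sup>2 \<le> (2 * B)\<^sup>2" for x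
      by (intro power_mono) auto
    then show "AE x in unit_leb. norm ((cmod (?f x - sine_sum a M x))\<^sup>2) \<le> (2 * B)\<^sup>2"
      by simp
  qed measurable
  with square_integrable_bounded[OF m fB] show ?thesis
    by (simp add: sine_series_def L2_sq_def)
qed

text \<open>By orthonormality the partial sums are Cauchy, with the tails R as bounds. A fast
  subsequence converges almost everywhere, and Fatou's lemma carries the tail bound over to its
  limit.\<close>

theorem riesz_fischer_sine:
  assumes a: "summable (\<lambda>n. (cmod (a n))\<^sup>2)"
  shows "\<exists>f. sine_series a f"
proof -
  define R where "R M = (\<Sum>n. (cmod (a (n + M)))\<^sup>2)" for M
  have sR: "summable (\<lambda>n. (cmod (a (n + M)))\<^sup>2)" for M
    using a by (simp add: summable_iff_shift[of "\<lambda>n. (cmod (a n))\<^sup>2"])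
  have R0: "R \<longlonglongrightarrow> 0"
    unfolding R_def using suminf_exist_split2[OF a] by simp
  have R_eq: "R M = (\<Sum>n. (cmod (a n))\<^sup>2) - (\<Sum>n<M. (cmod (a n))\<^sup>2)" for M
    unfolding R_def by (rule suminf_minus_initial_segment[OF a])
  have R_anti: "R M \<le> R K" if "K \<le> M" for K M
    unfolding R_eq using that by (intro diff_left_mono sum_mono2) auto
  have R_nonneg: "0 \<le> R M" for M unfolding R_def by (intro suminf_nonneg sR) auto
  have diff: "L2_sq (\<lambda>x. sine_sum a M x - sine_sum a K x) \<le> R K" if "K \<le> M" for K M
  proof -
    have "sine_sum a M x - sine_sum a K x = (\<Sum>n\<in>{K..<M}. a n * of_real (sine n x))" for x
      unfolding sine_sum_def using that by (simp add: sum_diff_nat_ivl flip: atLeast0LessThan)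
    then have "L2_sq (\<lambda>x. sine_sum a M x - sine_sum a K x) \<le> (\<Sum>n\<in>{K..<M}. (cmod (a n))\<^sup>2)"
      by (simp add: L2_sq_sine_poly_le)
    also have "\<dots> = (\<Sum>n<M. (cmod (a n))\<^sup>2) - (\<Sum>n<K. (cmod (a n))\<^sup>2)"
      using that by (simp add: sum_diff_nat_ivl flip: atLeast0LessThan)
    also have "\<dots> \<le> R K"
      unfolding R_eq using sum_le_suminf[OF a, of "{..<M}"] by simp
    finally show ?thesis .
  qed
  \<comment> \<open>The indices \<open>r k\<close> chosen below need not increase, so the bound is
    made symmetric in K and M.\<close>
  have diff': "L2_sq (\<lambda>x. sine_sum a M x - sine_sum a K x) \<le> max (R K) (R M)" for K M
  proof (cases "K \<le> M")
    case True
    with diff show ?thesis by (auto simp: max_def intro: order_trans)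
  next
    case False
    then have "L2_sq (\<lambda>x. sine_sum a K x - sine_sum a M x) \<le> R M" by (intro diff) auto
    then show ?thesis by (simp add: L2_sq_def norm_minus_commute le_max_iff_disj)
  qed
  \<comment> \<open>The rate 1/4 for squares gives the summable rate 1/2 for norms;
    \<open>r k \<ge> k\<close> makes the indices tend to infinity.\<close>
  have "\<exists>r\<ge>k. R r \<le> (1/4) ^ k" for k
  proof -
    have "\<forall>\<^sub>F M in sequentially. R M < (1/4) ^ k"
      using R0 by (rule order_tendstoD) simp
    then obtain K where K: "\<forall>M\<ge>K. R M < (1/4) ^ k" unfolding eventually_sequentially by blast
    from K have "R (max K k) < (1/4) ^ k" by simp
    then show ?thesis by (intro exI[of _ "max K k"]) auto
  qed
  then obtain r where r: "\<And>k. r k \<ge> k" "\<And>k. R (r k) \<le> (1/4) ^ k" by metis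
  define d where "d k x = sine_sum a (r (Suc k)) x - sine_sum a (r k) x" for k x
  have dsq: "square_integrable (d k)" for k
    unfolding d_def by (intro square_integrable_diff square_integrable_sine_sum)
  have [measurable]: "d k \<in> borel_measurable unit_leb" for k
    unfolding d_def by measurable
  have dint: "(LINT x|unit_leb. cmod (d k x)) \<le> (1/2) ^ k" for k
  proof -
    have "R (r (Suc k)) \<le> (1/4) ^ Suc k" by (rule r(2))
    also have "\<dots> \<le> (1/4) ^ k" by (intro power_decreasing) auto
    finally have "R (r (Suc k)) \<le> (1/4) ^ k" .
    then have "L2_sq (d k) \<le> (1/4) ^ k"
      using diff'[of "r (Suc k)" "r k"] r(2)[of k] unfolding d_def by linarith
    then have "sqrt (L2_sq (d k)) \<le> sqrt ((1/4) ^ k)" by simp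
    also have "\<dots> = (1/2) ^ k" by (simp add: real_sqrt_power real_sqrt_divide)
    finally show ?thesis using integral_norm_le_L2[OF dsq[of k]] by linarith
  qed
  \<comment> \<open>Monotone convergence: the sum of the absolute increments has a finite integral,
    hence is finite almost everywhere, and there the subsequence converges.\<close>
  have "(\<integral>\<^sup>+x. (\<Sum>k. ennreal (cmod (d k x))) \<partial>unit_leb) = (\<Sum>k. \<integral>\<^sup>+x. ennreal (cmod (d k x)) \<partial>unit_leb)"
    by (intro nn_integral_suminf) measurable
  also have "\<dots> = (\<Sum>k. ennreal (LINT x|unit_leb. cmod (d k x)))"
    by (subst nn_integral_eq_integral) (auto intro: integrable_square_integrable dsq)
  also have "\<dots> \<le> (\<Sum>k. ennreal ((1/2) ^ k))"
    by (intro suminf_le ennreal_leI dint) auto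
  also have "\<dots> = ennreal (\<Sum>k. (1/2) ^ k)"
    by (rule suminf_ennreal2) (auto intro: summable_geometric)
  finally have "(\<integral>\<^sup>+x. (\<Sum>k. ennreal (cmod (d k x))) \<partial>unit_leb) \<noteq> \<infinity>"
    by (auto simp: top_unique)
  then have "AE x in unit_leb. (\<Sum>k. ennreal (cmod (d k x))) \<noteq> \<infinity>"
    by (intro nn_integral_noteq_infinite) measurable
  then have conv: "AE x in unit_leb. convergent (\<lambda>k. sine_sum a (r k) x)"
  proof eventually_elim
    case (elim x)
    then have "summable (\<lambda>k. cmod (d k x))"
      by (intro summable_suminf_not_top) auto
    then have "summable (\<lambda>k. d k x)" by (rule summable_norm_cancel)
    then have "convergent (\<lambda>k. \<Sum>j<k. d j x)" by (simp add: summable_iff_convergent)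
    then have "convergent (\<lambda>k. (\<Sum>j<k. d j x) + sine_sum a (r 0) x)"
      by (simp add: convergent_add_const_right_iff)
    moreover have "(\<Sum>j<k. d j x) + sine_sum a (r 0) x = sine_sum a (r k) x" for k
      unfolding d_def by (subst sum_lessThan_telescope) simp
    ultimately show ?case by simp
  qed
  define f where "f x = lim (\<lambda>k. sine_sum a (r k) x)" for x
  have [measurable]: "f \<in> borel_measurable unit_leb"
    unfolding f_def by measurable
  have fatou: "(\<integral>\<^sup>+x. ennreal ((cmod (f x - sine_sum a M x))\<^sup>2) \<partial>unit_leb) \<le> ennreal (R M)" for M
  proof -
    have "(\<integral>\<^sup>+x. ennreal ((cmod (f x - sine_sum a M x))\<^sup>2) \<partial>unit_leb) =
      (\<integral>\<^sup>+x. liminf (\<lambda>k. ennreal ((cmod (sine_sum a (r k) x - sine_sum a M x))\<^sup>2)) \<partial>unit_leb)"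
    proof (rule nn_integral_cong_AE)
      show "AE x in unit_leb. ennreal ((cmod (f x - sine_sum a M x))\<^sup>2) =
        liminf (\<lambda>k. ennreal ((cmod (sine_sum a (r k) x - sine_sum a M x))\<^sup>2))"
        using conv
      proof eventually_elim
        case (elim x)
        then have "(\<lambda>k. sine_sum a (r k) x) \<longlonglongrightarrow> f x"
          unfolding f_def by (simp add: convergent_LIMSEQ_iff)
        then have "(\<lambda>k. ennreal ((cmod (sine_sum a (r k) x - sine_sum a M x))\<^sup>2)) \<longlonglongrightarrow>
            ennreal ((cmod (f x - sine_sum a M x))\<^sup>2)"
          by (intro tendsto_intros)
        then show ?case by (intro lim_imp_Liminf[symmetric]) auto
      qed
    qed
    also have "\<dots> \<le> liminf (\<lambda>k. \<integral>\<^sup>+x. ennreal ((cmod (sine_sum a (r k) x - sine_sum a M x))\<^sup>2) \<partial>unit_leb)"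
      by (intro nn_integral_liminf) measurable
    also have "\<dots> \<le> ennreal (R M)"
    proof (rule Liminf_le)
      show "\<forall>\<^sub>F k in sequentially. (\<integral>\<^sup>+x. ennreal ((cmod (sine_sum a (r k) x - sine_sum a M x))\<^sup>2) \<partial>unit_leb) \<le> ennreal (R M)"
        using eventually_ge_at_top[of M]
      proof eventually_elim
        case (elim k)
        have "square_integrable (\<lambda>x. sine_sum a (r k) x - sine_sum a M x)"
          by (intro square_integrable_diff square_integrable_sine_sum)
        then have "(\<integral>\<^sup>+x. ennreal ((cmod (sine_sum a (r k) x - sine_sum a M x))\<^sup>2) \<partial>unit_leb) =
          ennreal (L2_sq (\<lambda>x. sine_sum a (r k) x - sine_sum a M x))"
          unfolding L2_sq_def by (intro nn_integral_eq_integral) (auto simp: square_integrable_def)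
        also have "\<dots> \<le> ennreal (R M)"
          using elim r(1)[of k] by (intro ennreal_leI diff) auto
        finally show ?case .
      qed
    qed simp
    finally show ?thesis .
  qed
  have int: "integrable unit_leb (\<lambda>x. (cmod (f x - sine_sum a M x))\<^sup>2)" for M
    by (rule integrableI_nonneg) (auto intro: le_less_trans[OF fatou])
  \<comment> \<open>The empty partial sum is 0, so \<open>int\<close> at M = 0 speaks of f
    itself.\<close>
  have "square_integrable f"
    unfolding square_integrable_def using int[of 0] by (simp add: sine_sum_def)
  moreover have "(\<lambda>M. L2_sq (\<lambda>x. f x - sine_sum a M x)) \<longlonglongrightarrow> 0"
  proof (rule tendsto_sandwich[OF _ _ tendsto_const R0])
    have "L2_sq (\<lambda>x. f x - sine_sum a M x) \<le> R M" for M
    proof -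
      have "ennreal (L2_sq (\<lambda>x. f x - sine_sum a M x)) = (\<integral>\<^sup>+x. ennreal ((cmod (f x - sine_sum a M x))\<^sup>2) \<partial>unit_leb)"
        unfolding L2_sq_def by (intro nn_integral_eq_integral[symmetric] int) auto
      then have "ennreal (L2_sq (\<lambda>x. f x - sine_sum a M x)) \<le> ennreal (R M)" using fatou[of M] by (rule ord_eq_le_trans)
      then show ?thesis unfolding ennreal_le_iff[OF R_nonneg] .
    qed
    then show "\<forall>\<^sub>F M in sequentially. L2_sq (\<lambda>x. f x - sine_sum a M x) \<le> R M" by simp
  qed (simp add: L2_sq_nonneg)
  ultimately show ?thesis unfolding sine_series_def by blast
qed

section \<open>Weighted dilations of square-summable sequences\<close>

text \<open>For \<open>u n = \<lambda>\<^sub>n p\<^sup>\<alpha>\<close> this is, in the basis \<open>h\<^sub>n\<close>, the operator with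
  \<open>h\<^sub>n \<mapsto> w\<^sub>n\<close>.  Index \<open>0\<close> is a dummy: there only \<open>j = 0\<close> contributes and the value is \<open>a 0\<close>.\<close>

definition dilation_op :: "nat \<Rightarrow> (nat \<Rightarrow> real) \<Rightarrow> (nat \<Rightarrow> complex) \<Rightarrow> nat \<Rightarrow> complex" where
  "dilation_op p u a m =
     (\<Sum>j\<le>m. if p ^ j dvd m then of_real (u (m div p ^ j) ^ j) * a (m div p ^ j) else 0)"

lemma dilation_op_add: "dilation_op p u (\<lambda>n. a n + b n) = (\<lambda>m. dilation_op p u a m + dilation_op p u b m)"
  by (auto simp: dilation_op_def fun_eq_iff sum.distrib[symmetric] distrib_left intro!: sum.cong)

lemma dilation_op_scale: "dilation_op p u (\<lambda>n. c * a n) = (\<lambda>m. c * dilation_op p u a m)"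
  by (auto simp: dilation_op_def fun_eq_iff sum_distrib_left intro!: sum.cong)

lemma dilation_op_diff: "dilation_op p u (\<lambda>n. a n - b n) = (\<lambda>m. dilation_op p u a m - dilation_op p u b m)"
  by (auto simp: dilation_op_def fun_eq_iff sum_subtractf[symmetric] right_diff_distrib intro!: sum.cong)

text \<open>Forward substitution in a triangular system. The test \<open>1 < p\<close> sits inside
  the body so that every recursive call goes to a smaller index, whatever p is.\<close>

function dilation_inv :: "nat \<Rightarrow> (nat \<Rightarrow> real) \<Rightarrow> (nat \<Rightarrow> complex) \<Rightarrow> nat \<Rightarrow> complex" where
  "dilation_inv p u b m = b m - (\<Sum>j\<in>{1..m}. if 1 < p \<and> p ^ j dvd m
      then of_real (u (m div p ^ j) ^ j) * dilation_inv p u b (m div p ^ j) else 0)"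
  by auto
termination
proof (relation "Wellfounded.measure (\<lambda>(p, u, b, m). m)")
  fix p m j :: nat and u :: "nat \<Rightarrow> real" and b :: "nat \<Rightarrow> complex"
  assume "j \<in> {1..m}" "1 < p \<and> p ^ j dvd m"
  then have "m div p ^ j < m"
    by (intro div_less_dividend one_less_power) auto
  then show "((p, u, b, m div p ^ j), p, u, b, m) \<in> Wellfounded.measure (\<lambda>(p, u, b, m). m)"
    by simp
qed simp

declare dilation_inv.simps [simp del]

lemma dilation_op_split:
  "dilation_op p u a m = a m +
     (\<Sum>j\<in>{1..m}. if p ^ j dvd m then of_real (u (m div p ^ j) ^ j) * a (m div p ^ j) else 0)"
proof -
  have "{..m} = insert 0 {1..m}" by auto
  then show ?thesis by (simp add: dilation_op_def)
qed

lemma dilation_op_inv: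
  assumes "1 < p"
  shows "dilation_op p u (dilation_inv p u b) = b"
proof
  fix m
  show "dilation_op p u (dilation_inv p u b) m = b m"
    using assms by (subst dilation_op_split, subst dilation_inv.simps) simp
qed

text \<open>Beyond j = 0 only entries below m occur, with equal weights on both sides, so strong
  induction applies. Linearity of \<open>dilation_inv\<close> follows from this by applying
  \<open>dilation_op\<close> to both sides.\<close>

lemma dilation_op_inj:
  assumes "1 < p" and eq: "dilation_op p u a = dilation_op p u b"
  shows "a = b"
proof
  fix m
  show "a m = b m"
  proof (induction m rule: less_induct)
    case (less m)
    have "(\<Sum>j\<in>{1..m}. if p ^ j dvd m then of_real (u (m div p ^ j) ^ j) * a (m div p ^ j) else 0) =
      (\<Sum>j\<in>{1..m}. if p ^ j dvd m then of_real (u (m div p ^ j) ^ j) * b (m div p ^ j) else 0)"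
    proof (intro sum.cong refl)
      fix j assume "j \<in> {1..m}"
      then have "m div p ^ j < m"
        using assms(1) by (intro div_less_dividend one_less_power) auto
      then show "(if p ^ j dvd m then of_real (u (m div p ^ j) ^ j) * a (m div p ^ j) else 0) =
        (if p ^ j dvd m then of_real (u (m div p ^ j) ^ j) * b (m div p ^ j) else 0)"
        using less by simp
    qed
    with fun_cong[OF eq, of m] show ?case
      by (simp add: dilation_op_split)
  qed
qed

lemma dilation_inv_op: "1 < p \<Longrightarrow> dilation_inv p u (dilation_op p u a) = a"
  by (rule dilation_op_inj[where u = u]) (auto simp: dilation_op_inv)

lemma dilation_inv_add:
  "1 < p \<Longrightarrow> dilation_inv p u (\<lambda>n. a n + b n) = (\<lambda>m. dilation_inv p u a m + dilation_inv p u b m)"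
  by (rule dilation_op_inj[where u = u]) (auto simp: dilation_op_inv dilation_op_add)

lemma dilation_inv_scale:
  "1 < p \<Longrightarrow> dilation_inv p u (\<lambda>n. c * a n) = (\<lambda>m. c * dilation_inv p u a m)"
  by (rule dilation_op_inj[where u = u]) (auto simp: dilation_op_inv dilation_op_scale)

text \<open>A norm bound that includes membership in l2. Finite sections give access to the triangle
  inequality of \<open>L2_set\<close> without summability conditions; \<open>l2_bounded_imp\<close>
  and \<open>l2_boundedI\<close> translate to infinite sums.\<close>

definition l2_bounded :: "(nat \<Rightarrow> complex) \<Rightarrow> real \<Rightarrow> bool" where
  "l2_bounded a B \<longleftrightarrow> (\<forall>M. L2_set (\<lambda>n. cmod (a n)) {..M} \<le> B)"

lemma l2_bounded_nonneg: "l2_bounded a B \<Longrightarrow> 0 \<le> B"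
  unfolding l2_bounded_def by (meson L2_set_nonneg order_trans)

lemma l2_bounded_add:
  assumes "l2_bounded a A" "l2_bounded b B"
  shows "l2_bounded (\<lambda>n. a n + b n) (A + B)"
  unfolding l2_bounded_def
proof
  fix M
  have "L2_set (\<lambda>n. cmod (a n + b n)) {..M} \<le> L2_set (\<lambda>n. cmod (a n) + cmod (b n)) {..M}"
    by (intro L2_set_mono norm_triangle_ineq) auto
  also have "\<dots> \<le> L2_set (\<lambda>n. cmod (a n)) {..M} + L2_set (\<lambda>n. cmod (b n)) {..M}"
    by (rule L2_set_triangle_ineq)
  also have "\<dots> \<le> A + B"
    using assms by (intro add_mono) (auto simp: l2_bounded_def)
  finally show "L2_set (\<lambda>n. cmod (a n + b n)) {..M} \<le> A + B" .
qed

lemma l2_bounded_diff: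
  assumes "l2_bounded a A" "l2_bounded b B"
  shows "l2_bounded (\<lambda>n. a n - b n) (A + B)"
  using l2_bounded_add[of a A "\<lambda>n. - b n" B] assms by (simp add: l2_bounded_def)

lemma l2_bounded_point: "l2_bounded a B \<Longrightarrow> cmod (a n) \<le> B"
  unfolding l2_bounded_def
  using member_le_L2_set[of "{..n}" n "\<lambda>n. cmod (a n)"] by (auto intro: order_trans)

lemma l2_bounded_imp:
  assumes "l2_bounded a B"
  shows "summable (\<lambda>n. (cmod (a n))\<^sup>2)" "sqrt (\<Sum>n. (cmod (a n))\<^sup>2) \<le> B"
proof -
  have B: "0 \<le> B" using assms by (rule l2_bounded_nonneg)
  have le: "(\<Sum>n\<in>{..M}. (cmod (a n))\<^sup>2) \<le> B\<^sup>2" for M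
    using assms by (intro sqrt_le_D) (simp add: l2_bounded_def L2_set_def)
  then show s: "summable (\<lambda>n. (cmod (a n))\<^sup>2)"
    by (intro bounded_imp_summable[where B = "B\<^sup>2"]) auto
  have "(\<Sum>n. (cmod (a n))\<^sup>2) \<le> B\<^sup>2"
  proof (rule suminf_le_const[OF s])
    fix M
    have "(\<Sum>n<M. (cmod (a n))\<^sup>2) \<le> (\<Sum>n\<in>{..M}. (cmod (a n))\<^sup>2)"
      by (intro sum_mono2) auto
    with le[of M] show "(\<Sum>n<M. (cmod (a n))\<^sup>2) \<le> B\<^sup>2" by linarith
  qed
  with B show "sqrt (\<Sum>n. (cmod (a n))\<^sup>2) \<le> B"
    by (simp add: real_le_lsqrt)
qed

lemma l2_boundedI:
  assumes "summable (\<lambda>n. (cmod (a n))\<^sup>2)"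
  shows "l2_bounded a (sqrt (\<Sum>n. (cmod (a n))\<^sup>2))"
  unfolding l2_bounded_def L2_set_def
  using assms by (auto intro!: sum_le_suminf)

text \<open>Distinct multiples of q in \<open>{..M}\<close> pick up distinct entries of f, and these
  again have indices at most M.\<close>

lemma L2_set_dilate:
  assumes "q > 0"
  shows "L2_set (\<lambda>m. if q dvd m then f (m div q) else 0) {..M} \<le> L2_set f {..M::nat}"
proof -
  let ?S = "{m\<in>{..M}. q dvd m}"
  have inj: "inj_on (\<lambda>m. m div q) ?S"
  proof (rule inj_onI)
    fix x y assume "x \<in> ?S" "y \<in> ?S" "x div q = y div q"
    then have "q dvd x" "q dvd y" "x div q = y div q" by simp_all
    then show "x = y" by (rule dvd_div_eq_cancel[rotated])
  qed
  have "(\<Sum>m\<le>M. (if q dvd m then f (m div q) else 0)\<^sup>2) = (\<Sum>m\<in>?S. (f (m div q))\<^sup>2)"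
    by (intro sum.mono_neutral_cong_right) auto
  also have "\<dots> = (\<Sum>k\<in>(\<lambda>m. m div q) ` ?S. (f k)\<^sup>2)"
    by (subst sum.reindex[OF inj]) (simp add: o_def)
  also have "\<dots> \<le> (\<Sum>k\<le>M. (f k)\<^sup>2)"
  proof (rule sum_mono2)
    show "(\<lambda>m. m div q) ` ?S \<subseteq> {..M}"
    proof
      fix k assume "k \<in> (\<lambda>m. m div q) ` ?S"
      then obtain m where "m \<le> M" "k = m div q" by blast
      then show "k \<in> {..M}" using le_trans[OF div_le_dividend, of m M q] by simp
    qed
  qed auto
  finally show ?thesis by (simp add: L2_set_def)
qed

lemma L2_set_sum_triangle:
  "finite J \<Longrightarrow> L2_set (\<lambda>m. \<Sum>j\<in>J. g j m) A \<le> (\<Sum>j\<in>J. L2_set (g j) A)"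
proof (induction J rule: finite_induct)
  case empty
  then show ?case by (simp add: L2_set_def)
next
  case (insert x F)
  then show ?case
    using L2_set_triangle_ineq[of "g x" "\<lambda>m. \<Sum>j\<in>F. g j m" A] by simp
qed

lemma dvd_div_ge_1: "d dvd m \<Longrightarrow> m > 0 \<Longrightarrow> 1 \<le> m div d" for d m :: nat
  by (simp add: Suc_le_eq div_greater_zero_iff dvd_imp_le dvd_pos_nat)

text \<open>The j-th summand is a diagonal operator of norm at most \<open>\<nu> ^ j\<close>
  followed by a dilation, so the constant is the geometric sum.\<close>

lemma dilation_op_bounded:
  assumes p: "1 < p" and u: "\<And>n. n \<ge> 1 \<Longrightarrow> 0 \<le> u n \<and> u n \<le> \<nu>" and \<nu>: "0 \<le> \<nu>" "\<nu> < 1"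
    and a: "l2_bounded a B"
  shows "l2_bounded (dilation_op p u a) (B / (1 - \<nu>))"
  unfolding l2_bounded_def
proof
  fix M
  define g where "g j m = (if p ^ j dvd m then \<nu> ^ j * cmod (a (m div p ^ j)) else 0)" for j m
  have "cmod (dilation_op p u a m) \<le> (\<Sum>j\<in>{..M}. g j m)" if "m \<le> M" for m
  proof -
    have "cmod (dilation_op p u a m) \<le> (\<Sum>j\<in>{..m}. g j m)"
      unfolding dilation_op_def
    proof (rule sum_norm_le)
      fix j assume j: "j \<in> {..m}"
      show "cmod (if p ^ j dvd m then of_real (u (m div p ^ j) ^ j) * a (m div p ^ j) else 0) \<le> g j m"
      \<comment> \<open>Nothing is assumed of \<open>u 0\<close>; at m = 0 the only summand is j =
        0, where it has exponent 0.\<close>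
      proof (cases "m = 0")
        case True
        with j show ?thesis by (simp add: g_def)
      next
        case False
        have "\<bar>u (m div p ^ j)\<bar> ^ j \<le> \<nu> ^ j" if "p ^ j dvd m"
        proof -
          have "m div p ^ j \<ge> 1" using that False by (intro dvd_div_ge_1) auto
          from u[OF this] show ?thesis by (intro power_mono) auto
        qed
        then show ?thesis
          by (auto simp: g_def norm_mult norm_power power_abs intro!: mult_right_mono)
      qed
    qed
    \<comment> \<open>One range of j for all m up to M, so that the sum can be pulled out of
      \<open>L2_set\<close>.\<close>
    also have "\<dots> \<le> (\<Sum>j\<in>{..M}. g j m)"
      using that \<nu> by (intro sum_mono2) (auto simp: g_def)
    finally show ?thesis .
  qed
  then have "L2_set (\<lambda>m. cmod (dilation_op p u a m)) {..M} \<le> L2_set (\<lambda>m. \<Sum>j\<in>{..M}. g j m) {..M}"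
    by (intro L2_set_mono) auto
  also have "\<dots> \<le> (\<Sum>j\<in>{..M}. L2_set (g j) {..M})"
    by (intro L2_set_sum_triangle) auto
  also have "\<dots> \<le> (\<Sum>j\<in>{..M}. \<nu> ^ j * B)"
  proof (rule sum_mono)
    fix j
    have "L2_set (g j) {..M} \<le> L2_set (\<lambda>m. \<nu> ^ j * cmod (a m)) {..M}"
      unfolding g_def using p by (intro L2_set_dilate) auto
    also have "\<dots> = \<nu> ^ j * L2_set (\<lambda>m. cmod (a m)) {..M}"
      using \<nu> by (simp add: L2_set_right_distrib)
    also have "\<dots> \<le> \<nu> ^ j * B"
      using a \<nu> by (intro mult_left_mono) (auto simp: l2_bounded_def)
    finally show "L2_set (g j) {..M} \<le> \<nu> ^ j * B" .
  qed
  also have "\<dots> = (\<Sum>j\<in>{..M}. \<nu> ^ j) * B"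
    by (simp add: sum_distrib_right)
  also have "\<dots> \<le> 1 / (1 - \<nu>) * B"
  proof (rule mult_right_mono)
    have "(\<Sum>j\<in>{..M}. \<nu> ^ j) \<le> (\<Sum>j. \<nu> ^ j)"
      using \<nu> by (intro sum_le_suminf summable_geometric) auto
    also have "\<dots> = 1 / (1 - \<nu>)" using \<nu> by (intro suminf_geometric) auto
    finally show "(\<Sum>j\<in>{..M}. \<nu> ^ j) \<le> 1 / (1 - \<nu>)" .
  qed (use a l2_bounded_nonneg in auto)
  finally show "L2_set (\<lambda>m. cmod (dilation_op p u a m)) {..M} \<le> B / (1 - \<nu>)" by simp
qed

text \<open>Cancelling one factor p shifts j by one: apart from j = 0, the summands at p k are those
  at k with one more factor of u, taken at the source index.\<close>

lemma dilation_op_mult: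
  assumes p: "1 < p" and k: "k \<ge> 1"
  shows "dilation_op p u a (p * k) = a (p * k) +
    (\<Sum>j\<le>k. if p ^ j dvd k then of_real (u (k div p ^ j) ^ Suc j) * a (k div p ^ j) else 0)"
proof -
  let ?f = "\<lambda>j. if p ^ j dvd p * k then of_real (u (p * k div p ^ j) ^ j) * a (p * k div p ^ j) else 0"
  let ?g = "\<lambda>j. if p ^ j dvd k then of_real (u (k div p ^ j) ^ Suc j) * a (k div p ^ j) else 0"
  have kp: "j < p * k" if "j \<le> k" for j using p k that by (intro le_less_trans[OF that]) simp
  have "(\<Sum>j\<in>{1..p * k}. ?f j) = (\<Sum>j\<in>{0..<p * k}. ?f (Suc j))"
    by (rule sum.reindex_bij_witness[of _ Suc "\<lambda>j. j - 1"]) auto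
  also have "\<dots> = (\<Sum>j\<in>{0..<p * k}. ?g j)"
    using p by (intro sum.cong) (auto simp: div_mult2_eq)
  also have "\<dots> = (\<Sum>j\<le>k. ?g j)"
  proof (rule sum.mono_neutral_right)
    \<comment> \<open>As j < p^j, the cutoff \<open>j \<le> k\<close> in \<open>dilation_op\<close>
      loses no divisor of a positive k.\<close>
    have "\<not> p ^ j dvd k" if "k < j" for j
    proof
      assume "p ^ j dvd k"
      then have "p ^ j \<le> k" using k by (auto dest: dvd_imp_le)
      moreover have "j < p ^ j" using p by (simp add: power_gt_expt)
      ultimately show False using that by linarith
    qed
    then show "\<forall>j\<in>{0..<p * k} - {..k}. ?g j = 0" by auto
  qed (use kp in auto)
  finally show ?thesis by (simp add: dilation_op_split)
qed

text \<open>On sequences living where \<open>u\<close> is constant along the chains \<open>n, pn, p\<^sup>2n, \<dots>\<close> the inverse of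
  \<open>dilation_op\<close> is the identity minus one weighted dilation.\<close>

lemma dilation_tail_bounded:
  assumes p: "1 < p" and u: "\<And>n. n \<ge> 1 \<Longrightarrow> 0 \<le> u n \<and> u n \<le> 1"
    and N: "N \<ge> 1" "\<And>n. n \<ge> N \<Longrightarrow> u (p * n) = u n"
    and c: "\<And>n. n < N \<Longrightarrow> c n = 0"
    and b: "l2_bounded (dilation_op p u c) B"
  shows "l2_bounded c (2 * B)"
  unfolding l2_bounded_def
proof
  fix M
  define b where "b = dilation_op p u c"
  have up: "u (p ^ j * n) = u n" if "n \<ge> N" for j n
  proof (induction j)
    case (Suc j)
    have "1 * N \<le> p ^ j * n" using that p by (intro mult_mono) auto
    with Suc N(2)[of "p ^ j * n"] show ?case by (simp add: mult.assoc)
  qed simp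
  have rec: "c (p * k) = b (p * k) - of_real (u k) * b k" if "k \<ge> 1" for k
  proof -
    have "(\<Sum>j\<le>k. if p ^ j dvd k then of_real (u (k div p ^ j) ^ Suc j) * c (k div p ^ j) else 0)
      = (\<Sum>j\<le>k. of_real (u k) * (if p ^ j dvd k then of_real (u (k div p ^ j) ^ j) * c (k div p ^ j) else 0))"
    proof (rule sum.cong)
      fix j
      show "(if p ^ j dvd k then of_real (u (k div p ^ j) ^ Suc j) * c (k div p ^ j) else 0)
        = of_real (u k) * (if p ^ j dvd k then of_real (u (k div p ^ j) ^ j) * c (k div p ^ j) else 0)"
      \<comment> \<open>Either the source index is at least N, and u has the same value there and at
        k, or the entry of c at the source is 0.\<close>
      proof (cases "p ^ j dvd k \<and> k div p ^ j \<ge> N")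
        case True
        then have "u k = u (k div p ^ j)" using up[of "k div p ^ j" j] by simp
        then show ?thesis by simp
      next
        case False
        then show ?thesis using c by auto
      qed
    qed simp
    also have "\<dots> = of_real (u k) * b k"
      by (simp add: b_def dilation_op_def sum_distrib_left)
    finally show ?thesis
      using dilation_op_mult[OF p that, of u c] by (simp add: b_def)
  qed
  have le: "cmod (c m) \<le> cmod (b m) + (if p dvd m then cmod (b (m div p)) else 0)" for m
  proof (cases "p dvd m \<and> m \<noteq> 0")
    case True
    then obtain k where k: "m = p * k" "k \<ge> 1" using p by (auto elim!: dvdE)
    have "cmod (c m) \<le> cmod (b m) + cmod (of_real (u k) * b k)"
      unfolding k(1) rec[OF k(2)] by (rule norm_triangle_ineq4)
    also have "cmod (of_real (u k) * b k) \<le> 1 * cmod (b k)"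
      unfolding norm_mult using u[OF k(2)] by (intro mult_right_mono) auto
    finally show ?thesis using k p by simp
  next
    case False
    \<comment> \<open>Here c and b agree at m: no positive power of p divides m, or m = 0 and the
      range of j is empty.\<close>
    have "(\<Sum>j\<in>{1..m}. if p ^ j dvd m then complex_of_real (u (m div p ^ j) ^ j) * c (m div p ^ j) else 0) = 0"
    proof (intro sum.neutral ballI)
      fix j assume j: "j \<in> {1..m}"
      then have "p dvd p ^ j" "m \<noteq> 0" by (auto intro: dvd_power)
      with False have "\<not> p ^ j dvd m" by (meson dvd_trans)
      then show "(if p ^ j dvd m then complex_of_real (u (m div p ^ j) ^ j) * c (m div p ^ j) else 0) = 0"
        by simp
    qed
    then show ?thesis by (simp add: b_def dilation_op_split)
  qed
  \<comment> \<open>The factor 2 is 1 for the identity plus 1 for a dilation with weights at most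
    1.\<close>
  have "L2_set (\<lambda>n. cmod (c n)) {..M} \<le>
      L2_set (\<lambda>m. cmod (b m) + (if p dvd m then cmod (b (m div p)) else 0)) {..M}"
    using le by (intro L2_set_mono) auto
  also have "\<dots> \<le> L2_set (\<lambda>m. cmod (b m)) {..M} + L2_set (\<lambda>m. if p dvd m then cmod (b (m div p)) else 0) {..M}"
    by (rule L2_set_triangle_ineq)
  also have "L2_set (\<lambda>m. if p dvd m then cmod (b (m div p)) else 0) {..M} \<le> L2_set (\<lambda>m. cmod (b m)) {..M}"
    using p by (intro L2_set_dilate) auto
  also have "L2_set (\<lambda>m. cmod (b m)) {..M} + L2_set (\<lambda>m. cmod (b m)) {..M} \<le> 2 * B"
    using b unfolding l2_bounded_def b_def by (metis add_mono mult_2)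
  finally show "L2_set (\<lambda>n. cmod (c n)) {..M} \<le> 2 * B" by simp
qed

text \<open>Solving row by row: row N expresses \<open>c N\<close> by one entry of the image and at
  most N earlier entries with weights at most 1, so the constant grows from C to 1 + N C,
  independently of c and B.\<close>

lemma dilation_op_point_bounded:
  assumes p: "1 < p" and u: "\<And>n. n \<ge> 1 \<Longrightarrow> 0 \<le> u n \<and> u n \<le> 1"
  shows "\<exists>C\<ge>0. \<forall>c B. l2_bounded (dilation_op p u c) B \<longrightarrow> (\<forall>n<N. cmod (c n) \<le> C * B)"
proof (induction N)
  case 0
  show ?case by auto
next
  case (Suc N)
  then obtain C where C: "C \<ge> 0"
    "\<And>c B n. l2_bounded (dilation_op p u c) B \<Longrightarrow> n < N \<Longrightarrow> cmod (c n) \<le> C * B" by blast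
  let ?C = "max C (1 + real N * C)"
  have "cmod (c n) \<le> ?C * B" if b: "l2_bounded (dilation_op p u c) B" and "n < Suc N" for c B n
  proof (cases "n < N")
    case True
    have "cmod (c n) \<le> C * B" using C(2)[OF b True] .
    also have "\<dots> \<le> ?C * B" using l2_bounded_nonneg[OF b] by (intro mult_right_mono) auto
    finally show ?thesis .
  next
    case False
    with that have n: "n = N" by simp
    let ?s = "\<Sum>j\<in>{1..N}. if p ^ j dvd N then of_real (u (N div p ^ j) ^ j) * c (N div p ^ j) else 0"
    have "cmod ?s \<le> of_nat (card {1..N}) * (C * B)"
    proof (rule sum_norm_bound)
      fix j assume j: "j \<in> {1..N}"
      show "cmod (if p ^ j dvd N then of_real (u (N div p ^ j) ^ j) * c (N div p ^ j) else 0) \<le> C * B"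
      proof (cases "p ^ j dvd N")
        case True
        have "N div p ^ j \<ge> 1" using True j by (intro dvd_div_ge_1) auto
        from u[OF this] have 1: "\<bar>u (N div p ^ j) ^ j\<bar> \<le> 1"
          by (simp add: power_abs power_le_one)
        have "N div p ^ j < N" using p j by (intro div_less_dividend one_less_power) auto
        from C(2)[OF b this] have 2: "cmod (c (N div p ^ j)) \<le> C * B" .
        from mult_mono[OF 1 2] True show ?thesis by (simp add: norm_mult norm_power power_abs)
      next
        case False
        then show ?thesis using C(1) l2_bounded_nonneg[OF b] by simp
      qed
    qed
    moreover have "c N = dilation_op p u c N - ?s" by (subst dilation_op_split) simp
    moreover have "cmod (dilation_op p u c N) \<le> B" using b by (rule l2_bounded_point)
    ultimately have "cmod (c N) \<le> B + real N * (C * B)"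
      using norm_triangle_ineq4[of "dilation_op p u c N" ?s] by simp
    also have "\<dots> = (1 + real N * C) * B" by (simp add: algebra_simps)
    also have "\<dots> \<le> ?C * B" using l2_bounded_nonneg[OF b] by (intro mult_right_mono) auto
    finally show ?thesis by (simp add: n)
  qed
  then show ?case using C(1) by (intro exI[of _ ?C]) auto
qed

lemma dilation_op_bounded_below:
  assumes p: "1 < p" and u: "\<And>n. n \<ge> 1 \<Longrightarrow> 0 \<le> u n \<and> u n \<le> \<nu>" and \<nu>: "0 \<le> \<nu>" "\<nu> < 1"
    and N: "N \<ge> 1" "\<And>n. n \<ge> N \<Longrightarrow> u (p * n) = u n"
  shows "\<exists>C. \<forall>c B. l2_bounded (dilation_op p u c) B \<longrightarrow> l2_bounded c (C * B)"
proof -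
  have u1: "0 \<le> u n \<and> u n \<le> 1" if "n \<ge> 1" for n using u[OF that] \<nu> by linarith
  obtain C where C: "C \<ge> 0"
    "\<And>c B n. l2_bounded (dilation_op p u c) B \<Longrightarrow> n < N \<Longrightarrow> cmod (c n) \<le> C * B"
    using dilation_op_point_bounded[where u = u and N = N, OF p u1] by blast
  \<comment> \<open>The head has at most N entries of size at most \<open>C * B\<close>, and its l2
    norm is at most its l1 norm.\<close>
  let ?D = "real N * C"
  have "l2_bounded c ((?D + 2 * (1 + ?D / (1 - \<nu>))) * B)"
    if b: "l2_bounded (dilation_op p u c) B" for c B
  proof -
    define c1 where "c1 n = (if n < N then c n else 0)" for n
    define c2 where "c2 n = (if n < N then 0 else c n)" for n
    have c: "c = (\<lambda>n. c1 n + c2 n)" by (auto simp: c1_def c2_def)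
    have c1: "l2_bounded c1 (?D * B)"
      unfolding l2_bounded_def
    proof
      fix M
      have "L2_set (\<lambda>n. cmod (c1 n)) {..M} \<le> (\<Sum>n\<in>{..M}. cmod (c1 n))"
        by (intro L2_set_le_sum) auto
      also have "\<dots> \<le> (\<Sum>n\<in>{..<N}. cmod (c1 n))"
      proof -
        have "(\<Sum>n\<in>{..M}. cmod (c1 n)) = (\<Sum>n\<in>{..M} \<inter> {..<N}. cmod (c1 n))"
          by (intro sum.mono_neutral_right) (auto simp: c1_def)
        also have "\<dots> \<le> (\<Sum>n\<in>{..<N}. cmod (c1 n))" by (intro sum_mono2) auto
        finally show ?thesis .
      qed
      also have "\<dots> \<le> (\<Sum>n\<in>{..<N}. C * B)"
        using C(2)[OF b] by (intro sum_mono) (auto simp: c1_def)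
      finally show "L2_set (\<lambda>n. cmod (c1 n)) {..M} \<le> ?D * B" by simp
    qed
    \<comment> \<open>The image of the tail is not the tail of the image; it is bounded by
      \<open>B\<close> plus the image of the head, and \<open>dilation_tail_bounded\<close> doubles
      this.\<close>
    have "dilation_op p u c2 = (\<lambda>m. dilation_op p u c m - dilation_op p u c1 m)"
      by (subst dilation_op_diff[symmetric]) (simp add: c)
    then have "l2_bounded (dilation_op p u c2) (B + ?D * B / (1 - \<nu>))"
      using l2_bounded_diff[OF b dilation_op_bounded[OF p u \<nu> c1]] by simp
    from dilation_tail_bounded[OF p u1 N _ this]
    have "l2_bounded c2 (2 * (B + ?D * B / (1 - \<nu>)))" by (auto simp: c2_def)
    from l2_bounded_add[OF c1 this]
    show ?thesis unfolding c[symmetric] by (simp add: algebra_simps)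
  qed
  then show ?thesis by blast
qed

section \<open>Operators on the spaces \<open>H\<^sup>\<alpha>\<close>\<close>

lemma L2_cases:
  obtains f where "x = L2_class f" "square_integrable f"
proof
  show "x = L2_class (L2_rep x)" by (simp add: Quotient_abs_rep[OF Quotient_L2])
  show "square_integrable (L2_rep x)"
    using Quotient_rep_reflp[OF Quotient_L2, of x] by (simp add: L2_eq_def)
qed

lemma L2_eq_refl: "square_integrable f \<Longrightarrow> L2_eq f f"
  by (simp add: L2_eq_def)

lemma sine_coeff_class:
  assumes "square_integrable f"
  shows "sine_coeff (L2_class f) n = (LINT x|unit_leb. f x * of_real (sine n x))"
  using sine_coeff.abs_eq[OF L2_eq_refl[OF assms]]
  by (simp add: sine_def mult_ac flip: Bochner_Integration.integral_mult_right_zero)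

lemma sine_coeff_add: "sine_coeff (x + y) n = sine_coeff x n + sine_coeff y n"
proof -
  obtain f g where f: "x = L2_class f" "square_integrable f" and g: "y = L2_class g" "square_integrable g"
    using L2_cases by metis
  then show ?thesis
    by (simp add: plus_L2.abs_eq L2_eq_refl sine_coeff_class square_integrable_add distrib_right
        Bochner_Integration.integral_add integrable_mult_sine)
qed

lemma sine_coeff_scale: "sine_coeff (c *\<^sub>2 x) n = c * sine_coeff x n"
proof -
  obtain f where f: "x = L2_class f" "square_integrable f"
    using L2_cases by metis
  then show ?thesis
    by (simp add: scale_L2.abs_eq L2_eq_refl sine_coeff_class square_integrable_scale mult.assoc)
qed

lemma sine_coeff_0 [simp]: "sine_coeff x 0 = 0"
  by (rule L2_cases[of x]) (simp add: sine_coeff_class)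

text \<open>A square-summable sequence has such an f by Riesz-Fischer, and its class is independent
  of the choice by \<open>sine_series_unique\<close>.\<close>

definition sine_expansion :: "(nat \<Rightarrow> complex) \<Rightarrow> L2" where
  "sine_expansion a = L2_class (SOME f. sine_series a f)"

lemma sine_expansion_eq:
  assumes "sine_series a f"
  shows "sine_expansion a = L2_class f"
  unfolding sine_expansion_def
  by (intro Quotient_rel_abs[OF Quotient_L2] sine_series_unique[OF someI[of "sine_series a", OF assms] assms])

lemma sine_expansion_add:
  assumes "summable (\<lambda>n. (cmod (a n))\<^sup>2)" "summable (\<lambda>n. (cmod (b n))\<^sup>2)"
  shows "sine_expansion (\<lambda>n. a n + b n) = sine_expansion a + sine_expansion b"
proof -
  obtain f g where f: "sine_series a f" and g: "sine_series b g"
    using assms riesz_fischer_sine by blast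
  then have "square_integrable f" "square_integrable g" by (auto simp: sine_series_def)
  then show ?thesis
    using sine_expansion_eq[OF sine_series_add[OF f g]] sine_expansion_eq[OF f] sine_expansion_eq[OF g]
    by (simp add: plus_L2.abs_eq L2_eq_refl)
qed

lemma sine_expansion_scale:
  assumes "summable (\<lambda>n. (cmod (a n))\<^sup>2)"
  shows "sine_expansion (\<lambda>n. c * a n) = c *\<^sub>2 sine_expansion a"
proof -
  obtain f where f: "sine_series a f"
    using assms riesz_fischer_sine by blast
  then have "square_integrable f" by (auto simp: sine_series_def)
  then show ?thesis
    using sine_expansion_eq[OF sine_series_scale[OF f]] sine_expansion_eq[OF f]
    by (simp add: scale_L2.abs_eq L2_eq_refl)
qed

lemma sine_coeff_expansion:
  assumes "summable (\<lambda>n. (cmod (a n))\<^sup>2)" "n \<noteq> 0"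
  shows "sine_coeff (sine_expansion a) n = a n"
proof -
  obtain f where f: "sine_series a f"
    using assms riesz_fischer_sine by blast
  then have "square_integrable f" by (auto simp: sine_series_def)
  then show ?thesis
    using sine_series_coeff[OF f assms(2)] sine_expansion_eq[OF f] by (simp add: sine_coeff_class)
qed

text \<open>Coordinates in the basis h_n, in which the inner product of H^alpha becomes that of
  l2.\<close>

definition coord :: "real \<Rightarrow> L2 \<Rightarrow> nat \<Rightarrow> complex" where
  "coord \<alpha> f n = of_real (real n powr \<alpha>) * sine_coeff f n"

lemma coord_0 [simp]: "coord \<alpha> f 0 = 0"
  by (simp add: coord_def)

lemma coord_add: "coord \<alpha> (f + g) = (\<lambda>n. coord \<alpha> f n + coord \<alpha> g n)"
  by (simp add: fun_eq_iff coord_def sine_coeff_add distrib_left)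

lemma coord_scale: "coord \<alpha> (c *\<^sub>2 f) = (\<lambda>n. c * coord \<alpha> f n)"
  by (simp add: fun_eq_iff coord_def sine_coeff_scale)

lemma coord_diff: "coord \<alpha> (f - g) = (\<lambda>n. coord \<alpha> f n - coord \<alpha> g n)"
  using coord_add[of \<alpha> "f - g" g] by (simp add: fun_eq_iff)

lemma coord_sum: "finite F \<Longrightarrow> coord \<alpha> (\<Sum>i\<in>F. g i) n = (\<Sum>i\<in>F. coord \<alpha> (g i) n)"
proof (induction F rule: finite_induct)
  case empty
  show ?case using coord_diff[of \<alpha> 0 0] by simp
qed (simp add: coord_add)

lemma H_space_iff: "f \<in> H_space \<alpha> \<longleftrightarrow> summable (\<lambda>n. (cmod (coord \<alpha> f n))\<^sup>2)"
proof -
  have "(cmod (coord \<alpha> f (Suc n)))\<^sup>2 = real (Suc n) powr (2 * \<alpha>) * (cmod (sine_coeff f (Suc n)))\<^sup>2" for n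
    unfolding coord_def norm_mult power_mult_distrib mult_2 powr_add norm_of_real power2_eq_square by simp
  then show ?thesis
    using summable_Suc_iff[of "\<lambda>n. (cmod (coord \<alpha> f n))\<^sup>2"] by (simp add: H_space_def)
qed

lemma H_inner_coord: "H_inner \<alpha> f g = (\<Sum>n. coord \<alpha> f (Suc n) * cnj (coord \<alpha> g (Suc n)))"
  unfolding H_inner_def coord_def mult_2 powr_add
  by (simp add: mult_ac)

lemma norm_of_H_inner:
  assumes "f \<in> H_space \<alpha>"
  shows "norm_of (H_inner \<alpha>) f = sqrt (\<Sum>n. (cmod (coord \<alpha> f n))\<^sup>2)"
proof -
  have s: "summable (\<lambda>n. (cmod (coord \<alpha> f n))\<^sup>2)" using assms by (simp add: H_space_iff)
  then have s': "summable (\<lambda>n. (cmod (coord \<alpha> f (Suc n)))\<^sup>2)" 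
    by (subst summable_Suc_iff)
  have "H_inner \<alpha> f f = of_real (\<Sum>n. (cmod (coord \<alpha> f (Suc n)))\<^sup>2)"
    unfolding H_inner_coord complex_norm_square[symmetric] using s' by (rule suminf_of_real[symmetric])
  then show ?thesis
    using suminf_split_head[OF s] by (simp add: norm_of_def)
qed

lemma norm_of_H_inner_le:
  assumes "l2_bounded (coord \<alpha> f) B"
  shows "f \<in> H_space \<alpha>" "norm_of (H_inner \<alpha>) f \<le> B"
proof -
  show "f \<in> H_space \<alpha>" using l2_bounded_imp(1)[OF assms] by (simp add: H_space_iff)
  then show "norm_of (H_inner \<alpha>) f \<le> B"
    using l2_bounded_imp(2)[OF assms] by (simp add: norm_of_H_inner)
qed

lemma l2_bounded_coord: "f \<in> H_space \<alpha> \<Longrightarrow> l2_bounded (coord \<alpha> f) (norm_of (H_inner \<alpha>) f)"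
  using l2_boundedI[of "coord \<alpha> f"] by (simp add: norm_of_H_inner H_space_iff)

text \<open>Synthesis in the basis h_n: the class of the sum of \<open>a n\<close> times h_n over n
  \<ge> 1, for square-summable \<open>a\<close>.\<close>

definition H_expansion :: "real \<Rightarrow> (nat \<Rightarrow> complex) \<Rightarrow> L2" where
  "H_expansion \<alpha> a = sine_expansion (\<lambda>n. of_real (real n powr - \<alpha>) * a n)"

lemma summable_unweighted:
  assumes "\<alpha> \<ge> 0" "summable (\<lambda>n. (cmod (a n))\<^sup>2)"
  shows "summable (\<lambda>n. (cmod (of_real (real n powr - \<alpha>) * a n))\<^sup>2)"
proof (rule summable_comparison_test'[OF assms(2)])
  fix n :: nat
  have "real n powr - \<alpha> \<le> 1"
    using assms(1) powr_mono[of "- \<alpha>" 0 "real n"] by (cases "n = 0") auto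
  then have "(real n powr - \<alpha> * cmod (a n))\<^sup>2 \<le> (1 * cmod (a n))\<^sup>2"
    by (intro power_mono mult_right_mono) auto
  then show "norm ((cmod (of_real (real n powr - \<alpha>) * a n))\<^sup>2) \<le> (cmod (a n))\<^sup>2"
    by (simp add: norm_mult)
qed

lemma H_expansion_add:
  assumes "\<alpha> \<ge> 0" "summable (\<lambda>n. (cmod (a n))\<^sup>2)" "summable (\<lambda>n. (cmod (b n))\<^sup>2)"
  shows "H_expansion \<alpha> (\<lambda>n. a n + b n) = H_expansion \<alpha> a + H_expansion \<alpha> b"
  unfolding H_expansion_def distrib_left
  by (intro sine_expansion_add summable_unweighted assms)

lemma H_expansion_scale:
  assumes "\<alpha> \<ge> 0" "summable (\<lambda>n. (cmod (a n))\<^sup>2)"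
  shows "H_expansion \<alpha> (\<lambda>n. c * a n) = c *\<^sub>2 H_expansion \<alpha> a"
  using sine_expansion_scale[OF summable_unweighted[OF assms], of c]
  by (simp add: H_expansion_def mult.left_commute)

lemma coord_H_expansion:
  assumes "\<alpha> \<ge> 0" "summable (\<lambda>n. (cmod (a n))\<^sup>2)" "n \<noteq> 0"
  shows "coord \<alpha> (H_expansion \<alpha> a) n = a n"
  using sine_coeff_expansion[OF summable_unweighted[OF assms(1,2)] assms(3)] assms(3)
  by (simp add: coord_def H_expansion_def powr_minus field_simps flip: of_real_mult)

lemma summable_diff_l2:
  assumes "l2_bounded a A" "l2_bounded b B"
  shows "summable (\<lambda>n. (cmod (a n - b n))\<^sup>2)"
  using l2_bounded_imp(1)[OF l2_bounded_diff[OF assms]] .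

text \<open>The condition at index 0 makes \<open>T (coord \<alpha> f)\<close> vanish there, as
  every coordinate sequence does.\<close>

definition l2_operator :: "((nat \<Rightarrow> complex) \<Rightarrow> nat \<Rightarrow> complex) \<Rightarrow> bool" where
  "l2_operator T \<longleftrightarrow>
     (\<forall>a b. T (\<lambda>n. a n + b n) = (\<lambda>n. T a n + T b n)) \<and>
     (\<forall>c a. T (\<lambda>n. c * a n) = (\<lambda>n. c * T a n)) \<and>
     (\<forall>a. T a 0 = a 0) \<and>
     (\<exists>C. \<forall>a B. l2_bounded a B \<longrightarrow> l2_bounded (T a) (C * B))"

text \<open>Correcting \<open>f\<close> by an expansion, rather than expanding \<open>T (coord \<alpha> f)\<close> itself, makes
  \<open>lift_op\<close> multiplicative without using that a function with vanishing sine coefficients is zero.\<close>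

definition lift_op ::
    "real \<Rightarrow> ((nat \<Rightarrow> complex) \<Rightarrow> nat \<Rightarrow> complex) \<Rightarrow> L2 \<Rightarrow> L2" where
  "lift_op \<alpha> T f = f + H_expansion \<alpha> (\<lambda>n. T (coord \<alpha> f) n - coord \<alpha> f n)"

lemma l2_operator_bounded:
  assumes "l2_operator T" "f \<in> H_space \<alpha>"
  shows "\<exists>B. l2_bounded (T (coord \<alpha> f)) B"
  using assms l2_bounded_coord unfolding l2_operator_def by blast

lemma lift_op_summable:
  assumes "l2_operator T" "f \<in> H_space \<alpha>"
  shows "summable (\<lambda>n. (cmod (T (coord \<alpha> f) n - coord \<alpha> f n))\<^sup>2)"
  using l2_operator_bounded[OF assms] l2_bounded_coord[OF assms(2)] summable_diff_l2 by blast

lemma coord_lift_op: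
  assumes "\<alpha> \<ge> 0" "l2_operator T" "f \<in> H_space \<alpha>"
  shows "coord \<alpha> (lift_op \<alpha> T f) = T (coord \<alpha> f)"
proof
  fix n
  show "coord \<alpha> (lift_op \<alpha> T f) n = T (coord \<alpha> f) n"
  proof (cases "n = 0")
    case True
    then show ?thesis using assms(2) by (simp add: l2_operator_def)
  next
    case False
    then show ?thesis
      using coord_H_expansion[OF assms(1) lift_op_summable[OF assms(2,3)] False]
      by (simp add: lift_op_def coord_add)
  qed
qed

lemma bounded_operator_lift_op:
  assumes \<alpha>: "\<alpha> \<ge> 0" and T: "l2_operator T"
  shows "bounded_operator_on (H_space \<alpha>) (H_inner \<alpha>) (lift_op \<alpha> T)"
proof -
  obtain C where C: "\<And>a B. l2_bounded a B \<Longrightarrow> l2_bounded (T a) (C * B)"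
    using T unfolding l2_operator_def by blast
  have bound: "l2_bounded (coord \<alpha> (lift_op \<alpha> T f)) (C * norm_of (H_inner \<alpha>) f)" if "f \<in> H_space \<alpha>" for f
    unfolding coord_lift_op[OF \<alpha> T that] by (intro C l2_bounded_coord that)
  have "lift_op \<alpha> T (f + g) = lift_op \<alpha> T f + lift_op \<alpha> T g" if "f \<in> H_space \<alpha>" "g \<in> H_space \<alpha>" for f g
  proof -
    have "(\<lambda>n. T (coord \<alpha> (f + g)) n - coord \<alpha> (f + g) n) =
      (\<lambda>n. (T (coord \<alpha> f) n - coord \<alpha> f n) + (T (coord \<alpha> g) n - coord \<alpha> g n))"
      using T by (simp add: l2_operator_def coord_add add_diff_add)
    then show ?thesis
      using H_expansion_add[OF \<alpha> lift_op_summable[OF T that(1)] lift_op_summable[OF T that(2)]]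
      by (simp add: lift_op_def)
  qed
  moreover have "lift_op \<alpha> T (c *\<^sub>2 f) = c *\<^sub>2 lift_op \<alpha> T f" if "f \<in> H_space \<alpha>" for c f
  proof -
    have "(\<lambda>n. T (coord \<alpha> (c *\<^sub>2 f)) n - coord \<alpha> (c *\<^sub>2 f) n) =
      (\<lambda>n. c * (T (coord \<alpha> f) n - coord \<alpha> f n))"
      using T by (simp add: l2_operator_def coord_scale right_diff_distrib)
    then show ?thesis
      using H_expansion_scale[OF \<alpha> lift_op_summable[OF T that], of c]
      by (simp add: lift_op_def L2.scale_right_distrib)
  qed
  ultimately show ?thesis
    unfolding bounded_operator_on_def
    by (intro conjI ballI allI exI[of _ C] norm_of_H_inner_le[OF bound])
qed

text \<open>As S undoes T on coordinates, the correction added by S is the negative of the one added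
  by T, and the two cancel in L2.\<close>

lemma lift_op_inverse:
  assumes \<alpha>: "\<alpha> \<ge> 0" and T: "l2_operator T" and S: "l2_operator S" and ST: "\<And>a. S (T a) = a"
    and f: "f \<in> H_space \<alpha>"
  shows "lift_op \<alpha> S (lift_op \<alpha> T f) = f"
proof -
  let ?d = "\<lambda>n. T (coord \<alpha> f) n - coord \<alpha> f n"
  have "lift_op \<alpha> S (lift_op \<alpha> T f) =
      f + (H_expansion \<alpha> ?d + H_expansion \<alpha> (\<lambda>n. coord \<alpha> f n - T (coord \<alpha> f) n))"
    unfolding lift_op_def[of \<alpha> S] coord_lift_op[OF \<alpha> T f] ST by (simp add: lift_op_def add.assoc)
  also have "(\<lambda>n. coord \<alpha> f n - T (coord \<alpha> f) n) = (\<lambda>n. - 1 * ?d n)" by simp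
  also have "H_expansion \<alpha> \<dots> = - 1 *\<^sub>2 H_expansion \<alpha> ?d"
    by (rule H_expansion_scale[OF \<alpha> lift_op_summable[OF T f]])
  finally show ?thesis by simp
qed

lemma boundedly_invertible_lift_op:
  assumes "\<alpha> \<ge> 0" "l2_operator T" "l2_operator S" "\<And>a. S (T a) = a" "\<And>a. T (S a) = a"
  shows "boundedly_invertible_on (H_space \<alpha>) (H_inner \<alpha>) (lift_op \<alpha> T)"
  unfolding boundedly_invertible_on_def
  using bounded_operator_lift_op[OF assms(1)] lift_op_inverse[OF assms(1)] assms(2-5) by blast

section \<open>The orthonormal basis h_n and its images w_n\<close>

definition unit_seq :: "nat \<Rightarrow> nat \<Rightarrow> complex" where
  "unit_seq n m = (if m = n then 1 else 0)"

lemma summable_unit_seq: "summable (\<lambda>m. (cmod (unit_seq n m))\<^sup>2)"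
  by (rule summable_finite[of "{n}"]) (auto simp: unit_seq_def)

lemma coord_H_expansion_unit_seq:
  assumes "\<alpha> \<ge> 0" "n \<noteq> 0"
  shows "coord \<alpha> (H_expansion \<alpha> (unit_seq n)) = unit_seq n"
proof
  fix m
  show "coord \<alpha> (H_expansion \<alpha> (unit_seq n)) m = unit_seq n m"
  proof (cases "m = 0")
    case True
    then show ?thesis using assms(2) by (simp add: unit_seq_def)
  next
    case False
    then show ?thesis by (rule coord_H_expansion[OF assms(1) summable_unit_seq])
  qed
qed

lemma H_expansion_unit_seq_in: "\<alpha> \<ge> 0 \<Longrightarrow> n \<noteq> 0 \<Longrightarrow> H_expansion \<alpha> (unit_seq n) \<in> H_space \<alpha>"
  by (simp add: H_space_iff coord_H_expansion_unit_seq summable_unit_seq)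

lemma orthonormal_basis_H_expansion:
  assumes \<alpha>: "\<alpha> \<ge> 0"
  shows "orthonormal_basis (H_space \<alpha>) (H_inner \<alpha>) {1..} (\<lambda>n. H_expansion \<alpha> (unit_seq n))"
  unfolding orthonormal_basis_def
proof (intro conjI ballI allI impI)
  let ?e = "\<lambda>n. H_expansion \<alpha> (unit_seq n)"
  show "?e i \<in> H_space \<alpha>" if "i \<in> {1..}" for i
    using that \<alpha> by (intro H_expansion_unit_seq_in) auto
  show "H_inner \<alpha> (?e i) (?e j) = (if i = j then 1 else 0)" if "i \<in> {1..}" "j \<in> {1..}" for i j
  proof -
    have ij: "i \<noteq> 0" "j \<noteq> 0" using that by auto
    have "H_inner \<alpha> (?e i) (?e j) = (\<Sum>n. unit_seq i (Suc n) * cnj (unit_seq j (Suc n)))"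
      using ij by (simp add: H_inner_coord coord_H_expansion_unit_seq \<alpha>)
    \<comment> \<open>The inner product runs over \<open>Suc n\<close>, so index i is met at n = i -
      1.\<close>
    also have "\<dots> = (\<Sum>n\<in>{i - 1}. unit_seq i (Suc n) * cnj (unit_seq j (Suc n)))"
      by (rule suminf_finite) (auto simp: unit_seq_def)
    also have "\<dots> = (if i = j then 1 else 0)"
      using ij by (simp add: unit_seq_def)
    finally show ?thesis .
  qed
  fix f \<epsilon> assume f: "f \<in> H_space \<alpha>" and \<epsilon>: "(\<epsilon>::real) > 0"
  let ?u = "\<lambda>n. (cmod (coord \<alpha> f n))\<^sup>2"
  have s: "summable ?u" using f by (simp add: H_space_iff)
  have "\<forall>\<^sub>F M in sequentially. (\<Sum>n. ?u (n + M)) < \<epsilon>\<^sup>2"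
    using suminf_exist_split2[OF s] by (rule order_tendstoD) (use \<epsilon> in simp)
  then obtain M where M: "(\<Sum>n. ?u (n + M)) < \<epsilon>\<^sup>2"
    by (meson eventually_sequentially order_refl)
  \<comment> \<open>The expansion of f truncated at M. It starts at 1, and at 0 the coordinate of f
    vanishes anyway.\<close>
  define g where "g = (\<Sum>n\<in>{1..<M}. coord \<alpha> f n *\<^sub>2 ?e n)"
  have "g \<in> L2.span (?e ` {1..})"
    unfolding g_def by (intro L2.span_sum L2.span_scale L2.span_base) auto
  moreover have "norm_of (H_inner \<alpha>) (f - g) < \<epsilon>"
  proof -
    have g: "coord \<alpha> g m = (if m < M then coord \<alpha> f m else 0)" for m
    proof -
      have "coord \<alpha> g m = (\<Sum>n\<in>{1..<M}. coord \<alpha> f n * unit_seq n m)"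
        unfolding g_def by (simp add: coord_sum coord_scale coord_H_expansion_unit_seq \<alpha>)
      also have "\<dots> = (\<Sum>n\<in>{1..<M}. if n = m then coord \<alpha> f m else 0)"
        by (intro sum.cong) (auto simp: unit_seq_def)
      finally show ?thesis by (cases "m = 0") auto
    qed
    let ?v = "\<lambda>n. (cmod (coord \<alpha> (f - g) n))\<^sup>2"
    have v: "?v n = (if n < M then 0 else ?u n)" for n
      by (simp add: coord_diff g)
    have sv: "summable ?v"
      unfolding v by (rule summable_comparison_test'[OF s]) auto
    have "suminf ?v = (\<Sum>n. ?v (n + M)) + (\<Sum>n<M. ?v n)"
      by (rule suminf_split_initial_segment[OF sv])
    also have "\<dots> = (\<Sum>n. ?u (n + M))" by (simp add: v)
    finally have "sqrt (suminf ?v) < \<epsilon>"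
      using M \<epsilon> by (simp add: real_less_lsqrt)
    moreover have "f - g \<in> H_space \<alpha>" using sv by (simp add: H_space_iff)
    ultimately show ?thesis by (simp add: norm_of_H_inner)
  qed
  ultimately show "\<exists>g\<in>L2.span (?e ` {1..}). norm_of (H_inner \<alpha>) (f - g) < \<epsilon>" by blast
qed

text \<open>A summand at m survives only if m = n p^j, and n p^j determines j; so column n of the
  matrix lives on the chain of n.\<close>

lemma dilation_op_unit_seq:
  assumes p: "1 < p" and n: "n \<noteq> 0"
  shows "dilation_op p u (unit_seq n) (n * p ^ j) = of_real (u n ^ j)"
    and "m \<notin> range (\<lambda>j. n * p ^ j) \<Longrightarrow> dilation_op p u (unit_seq n) m = 0"
proof -
  have "j < p ^ j" using p by (simp add: power_gt_expt)
  \<comment> \<open>Ensures that j lies in the summation range of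
    \<open>dilation_op\<close>.\<close>
  then have "j \<le> n * p ^ j" using n
    by (metis One_nat_def Suc_leI less_imp_le_nat mult_le_mono nat_mult_1 not_gr_zero)
  have "i = j" if "p ^ i dvd n * p ^ j" "n * p ^ j div p ^ i = n" for i
  proof -
    have "n * p ^ j = n * p ^ i" using that by (metis dvd_div_mult_self)
    with n p show ?thesis by (simp add: power_inject_exp)
  qed
  then have "dilation_op p u (unit_seq n) (n * p ^ j) =
      (\<Sum>i\<le>n * p ^ j. if i = j then of_real (u n ^ j) else 0)"
    unfolding dilation_op_def using p by (intro sum.cong) (auto simp: unit_seq_def)
  also have "\<dots> = of_real (u n ^ j)" using \<open>j \<le> n * p ^ j\<close> by simp
  finally show "dilation_op p u (unit_seq n) (n * p ^ j) = of_real (u n ^ j)" .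
  assume m: "m \<notin> range (\<lambda>j. n * p ^ j)"
  show "dilation_op p u (unit_seq n) m = 0"
    unfolding dilation_op_def
  proof (intro sum.neutral ballI)
    fix j
    have "m div p ^ j \<noteq> n" if "p ^ j dvd m"
      using that m by (metis dvd_div_mult_self rangeI)
    then show "(if p ^ j dvd m then complex_of_real (u (m div p ^ j) ^ j) * unit_seq n (m div p ^ j) else 0) = 0"
      by (simp add: unit_seq_def)
  qed
qed

text \<open>The factor (n p^j)^(-alpha) of the expansion cancels p^(alpha j) in u_n^j and leaves
  n^(-alpha) lambda_n^j, the coefficients of w_n. They are absolutely summable, so the class is that
  of the pointwise series, reindexed along the chain.\<close>

lemma w_fun_eq_H_expansion:
  assumes p: "1 < p" and n: "n \<noteq> 0" and lam: "0 \<le> lam n" "lam n < 1"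
  shows "L2_class (\<lambda>x. complex_of_real (w_fun \<alpha> p lam n x)) =
    H_expansion \<alpha> (dilation_op p (\<lambda>k. lam k * real p powr \<alpha>) (unit_seq n))"
proof -
  define u where "u k = lam k * real p powr \<alpha>" for k
  define a where "a m = of_real (real m powr - \<alpha>) * dilation_op p u (unit_seq n) m" for m
  let ?g = "\<lambda>j. n * p ^ j"
  have mono: "strict_mono ?g"
    using p n by (intro strict_monoI) (simp add: power_strict_increasing)
  have a0: "a m = 0" if "m \<notin> range ?g" for m
    using dilation_op_unit_seq(2)[OF p n that] by (simp add: a_def)
  have ag: "a (?g j) = of_real (real n powr - \<alpha> * lam n ^ j)" for j
  proof -
    have "real (?g j) powr - \<alpha> * u n ^ j =
        real n powr - \<alpha> * ((real p powr - \<alpha>) ^ j * (real p powr \<alpha>) ^ j) * lam n ^ j"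
      using p by (simp add: u_def powr_mult power_mult_distrib powr_power powr_realpow[symmetric] powr_powr mult_ac)
    also have "(real p powr - \<alpha>) ^ j * (real p powr \<alpha>) ^ j = 1"
      using p by (simp add: powr_minus flip: power_mult_distrib)
    finally have "real (?g j) powr - \<alpha> * u n ^ j = real n powr - \<alpha> * lam n ^ j" by simp
    then show ?thesis
      unfolding a_def dilation_op_unit_seq(1)[OF p n] of_real_mult[symmetric] by (rule arg_cong)
  qed
  have geo: "summable (\<lambda>j. lam n ^ j)" using lam by (intro summable_geometric) auto
  have "summable (\<lambda>m. cmod (a m))"
  proof (subst summable_mono_reindex[OF mono, symmetric])
    show "summable (\<lambda>j. cmod (a (?g j)))"
      unfolding ag using lam geo by (simp add: norm_mult norm_power summable_mult)
  qed (simp add: a0)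
  from sine_expansion_eq[OF sine_series_absolutely_summable[OF this]]
  have "H_expansion \<alpha> (dilation_op p u (unit_seq n)) = L2_class (\<lambda>x. \<Sum>m. a m * of_real (sine m x))"
    by (simp add: H_expansion_def a_def)
  moreover have "(\<Sum>m. a m * of_real (sine m x)) = complex_of_real (w_fun \<alpha> p lam n x)" for x
  proof -
    have s: "summable (\<lambda>j. lam n ^ j * sin (real p ^ j * pi * (real n * x)))"
      by (rule summable_comparison_test'[OF geo])
         (use lam in \<open>auto simp: abs_mult power_abs intro!: mult_left_le\<close>)
    have "(\<Sum>m. a m * of_real (sine m x)) = (\<Sum>j. a (?g j) * of_real (sine (?g j) x))"
      by (rule suminf_mono_reindex[OF mono, symmetric]) (simp add: a0)
    also have "\<dots> = (\<Sum>j. complex_of_real (real n powr - \<alpha> * sqrt 2 * (lam n ^ j * sin (real p ^ j * pi * (real n * x)))))"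
      unfolding ag sine_def by (simp add: mult_ac)
    also have "\<dots> = complex_of_real (\<Sum>j. real n powr - \<alpha> * sqrt 2 * (lam n ^ j * sin (real p ^ j * pi * (real n * x))))"
      by (intro suminf_of_real[symmetric] summable_mult s)
    also have "\<dots> = complex_of_real (w_fun \<alpha> p lam n x)"
      unfolding suminf_mult[OF s] by (simp add: w_fun_def W_fun_def powr_minus_divide)
    finally show ?thesis .
  qed
  ultimately show ?thesis by (simp add: u_def[abs_def])
qed

lemma lift_op_H_expansion:
  assumes \<alpha>: "\<alpha> \<ge> 0" and T: "l2_operator T" and n: "n \<noteq> 0"
  shows "lift_op \<alpha> T (H_expansion \<alpha> (unit_seq n)) = H_expansion \<alpha> (T (unit_seq n))"
proof -
  let ?e = "H_expansion \<alpha> (unit_seq n)"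
  have c: "coord \<alpha> ?e = unit_seq n" by (rule coord_H_expansion_unit_seq[OF \<alpha> n])
  have "summable (\<lambda>m. (cmod (T (unit_seq n) m - unit_seq n m))\<^sup>2)"
    using lift_op_summable[OF T H_expansion_unit_seq_in[OF \<alpha> n]] unfolding c .
  from H_expansion_add[OF \<alpha> summable_unit_seq this, of n]
  show ?thesis unfolding lift_op_def c by simp
qed

theorem mainTheorem5:
  fixes \<alpha> :: real and p :: nat and lam :: "nat \<Rightarrow> real"
  assumes "\<alpha> \<ge> 0"
    and "p > 0" and "p \<noteq> 1"
    and "\<forall>n\<ge>1. lam n \<in> {0<..<real p powr (- \<alpha>)}"
    and "(SUP n\<in>{1..}. lam n) < real p powr (- \<alpha>)"
    and "\<exists>N\<ge>1. \<forall>n\<ge>N. lam n = lam (p * n)"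
  shows "riesz_basis (H_space \<alpha>) (H_inner \<alpha>) {1..}
           (\<lambda>n. L2_class (\<lambda>x. complex_of_real (w_fun \<alpha> p lam n x)))"
proof -
  have p: "1 < p" using assms(2,3) by linarith
  define u where "u n = lam n * real p powr \<alpha>" for n
  define \<nu> where "\<nu> = (SUP n\<in>{1..}. lam n) * real p powr \<alpha>"
  have bdd: "bdd_above (lam ` {1..})"
    using assms(4) by (intro bdd_aboveI2[where M = "real p powr - \<alpha>"]) (auto intro: less_imp_le)
  have u: "0 \<le> u n \<and> u n \<le> \<nu>" if "n \<ge> 1" for n
    using that assms(4) cSUP_upper[OF _ bdd, of n] unfolding u_def \<nu>_def
    by (auto intro!: mult_right_mono intro: less_imp_le)
  have \<nu>0: "0 \<le> \<nu>" using u[of 1] by linarith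
  \<comment> \<open>The strict bound on the supremum, not merely on each \<open>lam n\<close>, is
    what gives a geometric series uniform in n.\<close>
  have "\<nu> < real p powr - \<alpha> * real p powr \<alpha>"
    unfolding \<nu>_def using assms(5) p by (intro mult_strict_right_mono) auto
  then have \<nu>1: "\<nu> < 1" using p by (simp flip: powr_add)
  obtain N where N: "N \<ge> 1" "\<And>n. n \<ge> N \<Longrightarrow> u (p * n) = u n"
    using assms(6) unfolding u_def by metis
  obtain C where C: "\<And>c B. l2_bounded (dilation_op p u c) B \<Longrightarrow> l2_bounded c (C * B)"
    using dilation_op_bounded_below[where u = u, OF p u \<nu>0 \<nu>1 N] by blast
  have T: "l2_operator (dilation_op p u)"
    unfolding l2_operator_def
  proof (intro conjI allI exI impI)
    fix a B assume "l2_bounded a B"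
    from dilation_op_bounded[where u = u, OF p u \<nu>0 \<nu>1 this]
    show "l2_bounded (dilation_op p u a) (1 / (1 - \<nu>) * B)" by simp
  qed (simp_all add: dilation_op_add dilation_op_scale dilation_op_split)
  have S: "l2_operator (dilation_inv p u)"
    unfolding l2_operator_def
  proof (intro conjI allI exI impI)
    fix a B assume "l2_bounded a B"
    \<comment> \<open>The lower bound for \<open>dilation_op\<close>, read at the preimage
      \<open>dilation_inv p u a\<close>.\<close>
    then show "l2_bounded (dilation_inv p u a) (C * B)"
      by (intro C) (simp add: dilation_op_inv[OF p])
  next
    fix a show "dilation_inv p u a 0 = a 0" by (subst dilation_inv.simps) simp
  qed (use p in \<open>simp_all add: dilation_inv_add dilation_inv_scale\<close>)
  have "L2_class (\<lambda>x. complex_of_real (w_fun \<alpha> p lam n x)) =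
      lift_op \<alpha> (dilation_op p u) (H_expansion \<alpha> (unit_seq n))" if n: "n \<in> {1..}" for n
  proof -
    \<comment> \<open>Gives \<open>lam n < 1\<close>, so that the series of w_n converges
      absolutely.\<close>
    have "real p powr - \<alpha> \<le> real p powr 0" using assms(1) p by (intro powr_mono) auto
    moreover have "0 < lam n" "lam n < real p powr - \<alpha>" using n assms(4) by auto
    ultimately have "L2_class (\<lambda>x. complex_of_real (w_fun \<alpha> p lam n x)) =
        H_expansion \<alpha> (dilation_op p u (unit_seq n))"
      unfolding u_def using p n by (intro w_fun_eq_H_expansion) auto
    then show ?thesis using lift_op_H_expansion[OF assms(1) T, of n] n by simp
  qed
  moreover have "boundedly_invertible_on (H_space \<alpha>) (H_inner \<alpha>) (lift_op \<alpha> (dilation_op p u))"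
    using assms(1) T S by (rule boundedly_invertible_lift_op) (simp_all add: dilation_inv_op[OF p] dilation_op_inv[OF p])
  ultimately show ?thesis
    unfolding riesz_basis_def using orthonormal_basis_H_expansion[OF assms(1)] by blast
qed

end
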